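(* For $x\in(0,\infty)$, the game $\mathrm{Standard}(x)=\mathrm{Trail}(0,1,x,0)$ has a time-invariant Nash equilibrium if and only if $x\in[\lambda,\lambda^{-1}]$.
   Context: Trail of Lost Pennies $\mathrm{Trail}(m_{-\infty},m_\infty,n_{-\infty},n_\infty)$ (data with $m_{-\infty}<m_\infty$, $n_\infty<n_{-\infty}$, and fixed reals $m_*\le m_{-\infty}$, $n_*\le n_\infty$): a strategy is a map $S:\mathbb{Z}\times\mathbb{N}_+\to[0,\infty)$, time-invariant if $S(i,j)$ does not depend on $j$. For a strategy pair $(S_-,S_+)$ (Mina's, Maxine's) and $k\in\mathbb{Z}$, gameplay $X:\mathbb{N}\to\mathbb{Z}$ has $X_0=k$ and, given the past, steps $+1$ with probability $\frac{S_+(X_{i-1},i)}{S_-(X_{i-1},i)+S_+(X_{i-1},i)}$ and $-1$ otherwise ($0/0=1/2$). With $E_-=\{\limsup X_n=-\infty\}$, $E_+=\{\liminf X_n=\infty\}$, $E=E_-\cup E_+$: Mina's payoff $P_-=-\sum_{t\ge1}S_-(X_{t-1},t)+T_-$, $T_-=n_{-\infty},n_\infty,n_*$ on $E_-,E_+,E^c$; Maxine's payoff $P_+=-\sum_{t\ge1}S_+(X_{t-1},t)+T_+$, $T_+=m_{-\infty},m_\infty,m_*$ on $E_-,E_+,E^c$. $(S_-,S_+)$ is a Nash equilibrium if for every strategy $S$ and every starting point $k$, $\mathbb{E}^k_{S_-,S_+}[P_+]\ge\mathbb{E}^k_{S_-,S}[P_+]$ and $\mathbb{E}^k_{S_-,S_+}[P_-]\ge\mathbb{E}^k_{S,S_+}[P_-]$.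 ABMN system on $\mathbb{Z}$: variables $a_i,b_i\ge0$, $m_i,n_i\in\mathbb{R}$ with, for all $i$, $(a_i+b_i)(m_i+a_i)=a_im_{i+1}+b_im_{i-1}$, $(a_i+b_i)(n_i+b_i)=a_in_{i+1}+b_in_{i-1}$, $(a_i+b_i)^2=b_i(m_{i+1}-m_{i-1})$, $(a_i+b_i)^2=a_i(n_{i-1}-n_{i+1})$; positive if all $a_i,b_i>0$; the Mina margin is $\frac{n_{-\infty}-n_\infty}{m_\infty-m_{-\infty}}$ where $m_{\pm\infty},n_{\pm\infty}$ are the limits of $m_i,n_i$ as $i\to\pm\infty$. $\lambda\in(0,1]$ denotes the infimum of the Mina margins of positive ABMN solutions (the set of these margins is $[\lambda,\lambda^{-1}]$). *)

theory Defs
  imports "HOL-Probability.Probability"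
begin

text \<open>A strategy is a map from Z x N_+ to [0,inf). We use type int => nat => real;
  the value at time index 0 is never used (it is only required to be nonnegative).\<close>

definition strategy :: "(int \<Rightarrow> nat \<Rightarrow> real) \<Rightarrow> bool" where
  "strategy S \<longleftrightarrow> (\<forall>i j. 0 \<le> S i j)"

definition time_invariant :: "(int \<Rightarrow> nat \<Rightarrow> real) \<Rightarrow> bool" where
  "time_invariant S \<longleftrightarrow> (\<forall>i j j'. 1 \<le> j \<longrightarrow> 1 \<le> j' \<longrightarrow> S i j = S i j')"

definition up_prob :: "(int \<Rightarrow> nat \<Rightarrow> real) \<Rightarrow> (int \<Rightarrow> nat \<Rightarrow> real) \<Rightarrow> int \<Rightarrow> nat \<Rightarrow> real" where
  "up_prob Sm Sp i t =
     (if Sm i t + Sp i t = 0 then 1/2 else Sp i t / (Sm i t + Sp i t))"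

text \<open>Gameplay driven by i.i.d. uniform random variables: step n+1 (at time n+1, from X_n)
  goes up iff the n-th uniform variable is below the up-probability.\<close>
primrec gameplay :: "(int \<Rightarrow> nat \<Rightarrow> real) \<Rightarrow> (int \<Rightarrow> nat \<Rightarrow> real) \<Rightarrow> int \<Rightarrow> (nat \<Rightarrow> real) \<Rightarrow> nat \<Rightarrow> int" where
  "gameplay Sm Sp k \<omega> 0 = k"
| "gameplay Sm Sp k \<omega> (Suc n) = gameplay Sm Sp k \<omega> n +
     (if \<omega> n < up_prob Sm Sp (gameplay Sm Sp k \<omega> n) (Suc n) then 1 else -1)"

definition noise :: "(nat \<Rightarrow> real) measure" where
  "noise = PiM UNIV (\<lambda>_. uniform_measure lborel {0..1::real})"

definition escape_left :: "(nat \<Rightarrow> int) \<Rightarrow> bool" where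
  "escape_left X \<longleftrightarrow> limsup (\<lambda>n. ereal (real_of_int (X n))) = -\<infinity>"

definition escape_right :: "(nat \<Rightarrow> int) \<Rightarrow> bool" where
  "escape_right X \<longleftrightarrow> liminf (\<lambda>n. ereal (real_of_int (X n))) = \<infinity>"

definition terminal :: "real \<Rightarrow> real \<Rightarrow> real \<Rightarrow> (nat \<Rightarrow> int) \<Rightarrow> real" where
  "terminal vL vR vstar X =
     (if escape_left X then vL else if escape_right X then vR else vstar)"

definition running_cost :: "(int \<Rightarrow> nat \<Rightarrow> real) \<Rightarrow> (nat \<Rightarrow> int) \<Rightarrow> ennreal" where
  "running_cost S X = (\<Sum>t. ennreal (S (X t) (Suc t)))"

text \<open>Expected payoff E[T - cost] = E[T] - E[cost], in [-inf, inf) (T is bounded).\<close>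
definition expected_payoff ::
  "real \<Rightarrow> real \<Rightarrow> real \<Rightarrow> (int \<Rightarrow> nat \<Rightarrow> real) \<Rightarrow>
   (int \<Rightarrow> nat \<Rightarrow> real) \<Rightarrow> (int \<Rightarrow> nat \<Rightarrow> real) \<Rightarrow> int \<Rightarrow> ereal" where
  "expected_payoff vL vR vstar S Sm Sp k =
     ereal (\<integral>\<omega>. terminal vL vR vstar (gameplay Sm Sp k \<omega>) \<partial>noise)
     - enn2ereal (\<integral>\<^sup>+\<omega>. running_cost S (gameplay Sm Sp k \<omega>) \<partial>noise)"

definition mina_payoff ::
  "real \<Rightarrow> real \<Rightarrow> real \<Rightarrow> (int \<Rightarrow> nat \<Rightarrow> real) \<Rightarrow> (int \<Rightarrow> nat \<Rightarrow> real) \<Rightarrow> int \<Rightarrow> ereal" where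
  "mina_payoff nL nR nstar Sm Sp k = expected_payoff nL nR nstar Sm Sm Sp k"

definition maxine_payoff ::
  "real \<Rightarrow> real \<Rightarrow> real \<Rightarrow> (int \<Rightarrow> nat \<Rightarrow> real) \<Rightarrow> (int \<Rightarrow> nat \<Rightarrow> real) \<Rightarrow> int \<Rightarrow> ereal" where
  "maxine_payoff mL mR mstar Sm Sp k = expected_payoff mL mR mstar Sp Sm Sp k"

definition nash_equilibrium ::
  "real \<Rightarrow> real \<Rightarrow> real \<Rightarrow> real \<Rightarrow> real \<Rightarrow> real \<Rightarrow>
   (int \<Rightarrow> nat \<Rightarrow> real) \<Rightarrow> (int \<Rightarrow> nat \<Rightarrow> real) \<Rightarrow> bool" where
  "nash_equilibrium mL mR nL nR mstar nstar Sm Sp \<longleftrightarrow>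
     strategy Sm \<and> strategy Sp \<and>
     (\<forall>S k. strategy S \<longrightarrow>
        maxine_payoff mL mR mstar Sm Sp k \<ge> maxine_payoff mL mR mstar Sm S k \<and>
        mina_payoff nL nR nstar Sm Sp k \<ge> mina_payoff nL nR nstar S Sp k)"

definition ABMN_solution ::
  "(int \<Rightarrow> real) \<Rightarrow> (int \<Rightarrow> real) \<Rightarrow> (int \<Rightarrow> real) \<Rightarrow> (int \<Rightarrow> real) \<Rightarrow> bool" where
  "ABMN_solution a b m n \<longleftrightarrow>
     (\<forall>i. 0 \<le> a i \<and> 0 \<le> b i \<and>
        (a i + b i) * (m i + a i) = a i * m (i + 1) + b i * m (i - 1) \<and>
        (a i + b i) * (n i + b i) = a i * n (i + 1) + b i * n (i - 1) \<and>
        (a i + b i)^2 = b i * (m (i + 1) - m (i - 1)) \<and>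
        (a i + b i)^2 = a i * (n (i - 1) - n (i + 1)))"

definition positive_ABMN ::
  "(int \<Rightarrow> real) \<Rightarrow> (int \<Rightarrow> real) \<Rightarrow> (int \<Rightarrow> real) \<Rightarrow> (int \<Rightarrow> real) \<Rightarrow> bool" where
  "positive_ABMN a b m n \<longleftrightarrow> ABMN_solution a b m n \<and> (\<forall>i. 0 < a i \<and> 0 < b i)"

definition mina_margins :: "real set" where
  "mina_margins = {(nL - nR) / (mR - mL) | a b m n mL mR nL nR.
      positive_ABMN a b m n \<and>
      (m \<longlongrightarrow> mL) at_bot \<and> (m \<longlongrightarrow> mR) at_top \<and>
      (n \<longlongrightarrow> nL) at_bot \<and> (n \<longlongrightarrow> nR) at_top}"

definition lambda_ABMN :: real where
  "lambda_ABMN = Inf mina_margins"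

end

theory Submission
  imports Defs
begin

text \<open>
At a positive site the four ABMN equations are equivalent to
\<open>m\<^sub>i - m\<^sub>i\<^sub>-\<^sub>1 = a\<^sub>i\<^sup>2 / b\<^sub>i\<close>, \<open>m\<^sub>i\<^sub>+\<^sub>1 - m\<^sub>i = 2 a\<^sub>i + b\<^sub>i\<close>,
\<open>n\<^sub>i - n\<^sub>i\<^sub>+\<^sub>1 = b\<^sub>i\<^sup>2 / a\<^sub>i\<close>, \<open>n\<^sub>i\<^sub>-\<^sub>1 - n\<^sub>i = 2 b\<^sub>i + a\<^sub>i\<close>.
Hence the ratios \<open>r = b\<^sub>i / a\<^sub>i\<close> obey \<open>r' (1 + 2 r') = r\<^sup>2 / (2 + r)\<close> with
\<open>a\<^sub>i\<^sub>+\<^sub>1 = a\<^sub>i r' (2 + r)\<close>; in particular \<open>r' \<le> r / 2\<close>, so all increments are summable and the Mina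
margin is a continuous function of the ratio at one site. Every solution has a ratio in
\<open>[1/5, 1]\<close>, so the set of margins is compact and connected, and the reflection
\<open>i \<mapsto> - i\<close>, \<open>a \<leftrightarrow> b\<close>, \<open>m \<leftrightarrow> n\<close> inverts margins: the set is \<open>[\<lambda>, 1/\<lambda>]\<close> with \<open>\<lambda> > 0\<close>.

If \<open>(a, b, m, n)\<close> is a positive solution, then against \<open>b\<close> the value \<open>m\<close> minus the accumulated cost
is a supermartingale for every reply of Maxine and a martingale for \<open>a\<close>. In the latter case
the expected total cost is finite, so almost surely every site is visited finitely often and the
counter escapes. Conversely, one-step deviations from a time-invariant equilibrium show that at
each site either both stakes vanish and \<open>m\<close> is nonincreasing there, or both are positive and the ABMN
equations hold with \<open>m\<close> increasing; hence one alternative holds at all sites. The vanishing one is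
excluded because either player could then buy every turn at negligible cost. The boundary values
of the solution are forced because the probability of escaping left tends to 0 and 1 as the
starting point tends to \<open>\<infinity>\<close> and \<open>- \<infinity>\<close>.
\<close>

section \<open>Ratio recursion and margin function\<close>

text \<open>Positive root \<open>y\<close> of \<open>y * (1 + 2 * y) = r\<^sup>2 / (2 + r)\<close>,
  the equation between the ratios \<open>b / a\<close> at neighbouring sites.\<close>

definition next_ratio :: "real \<Rightarrow> real" where
  "next_ratio r = (sqrt (1 + 8 * (r\<^sup>2 / (2 + r))) - 1) / 4"

lemma next_ratio_pos: "0 < next_ratio r" if "0 < r"
proof -
  have "0 < r\<^sup>2 / (2 + r)"
    using that by (intro divide_pos_pos) auto
  then show ?thesis
    unfolding next_ratio_def by simp
qed

lemma next_ratio_eq: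
  assumes "0 < r"
  shows "next_ratio r * (1 + 2 * next_ratio r) = r\<^sup>2 / (2 + r)"
proof -
  define s where "s = sqrt (1 + 8 * (r\<^sup>2 / (2 + r)))"
  have "0 \<le> r\<^sup>2 / (2 + r)"
    using assms by (intro divide_nonneg_pos) auto
  then have s: "s\<^sup>2 = 1 + 8 * (r\<^sup>2 / (2 + r))"
    unfolding s_def by (intro real_sqrt_pow2) linarith
  have "next_ratio r * (1 + 2 * next_ratio r) = (s\<^sup>2 - 1) / 8"
    unfolding next_ratio_def s_def[symmetric] by (simp add: field_simps power2_eq_square)
  then show ?thesis unfolding s by (metis add_diff_cancel_left' nonzero_mult_div_cancel_left zero_neq_numeral)
qed

text \<open>The quadratic is strictly increasing on nonnegative reals, so ratios can be compared
  through their defining equation, without touching the square root.\<close>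

lemma ratio_quadratic_mono:
  fixes y z :: real
  assumes "0 \<le> y" "0 \<le> z" "y * (1 + 2 * y) \<le> z * (1 + 2 * z)"
  shows "y \<le> z"
proof (rule ccontr)
  assume "\<not> y \<le> z"
  then have "z * (1 + 2 * z) < y * (1 + 2 * y)"
    using assms by (intro mult_strict_mono) auto
  with assms show False by simp
qed

lemma next_ratio_unique:
  assumes "0 < r" "0 < y" "y * (1 + 2 * y) = r\<^sup>2 / (2 + r)"
  shows "y = next_ratio r"
proof -
  note facts = next_ratio_eq[OF assms(1)] next_ratio_pos[OF assms(1)] assms
  have "y \<le> next_ratio r"
    by (rule ratio_quadratic_mono) (use facts in linarith)+
  moreover have "next_ratio r \<le> y"
    by (rule ratio_quadratic_mono) (use facts in linarith)+
  ultimately show ?thesis by simp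
qed

text \<open>By monotonicity of the quadratic this reduces to
  \<open>2 * r \<le> (1 + r) * (2 + r)\<close>. It is the source of all decay estimates.\<close>

lemma next_ratio_le_half:
  assumes "0 < r"
  shows "next_ratio r \<le> r / 2"
proof (rule ratio_quadratic_mono)
  have "r\<^sup>2 / (2 + r) \<le> r / 2 * (1 + 2 * (r / 2))"
    using assms by (simp add: divide_simps) (simp add: algebra_simps power2_eq_square)
  then show "next_ratio r * (1 + 2 * next_ratio r) \<le> r / 2 * (1 + 2 * (r / 2))"
    using next_ratio_eq[OF assms] by simp
qed (use assms next_ratio_pos[of r] in auto)

section \<open>Iterated ratios, normalised stakes and a summable majorant\<close>

definition ratio :: "real \<Rightarrow> nat \<Rightarrow> real" where
  "ratio r j = (next_ratio ^^ j) r"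

lemma ratio_0 [simp]: "ratio r 0 = r"
  and ratio_Suc: "ratio r (Suc j) = next_ratio (ratio r j)"
  by (simp_all add: ratio_def)

lemma ratio_pos: "0 < r \<Longrightarrow> 0 < ratio r j"
  by (induction j) (simp_all add: ratio_Suc next_ratio_pos)

lemma ratio_le: "0 < r \<Longrightarrow> ratio r j \<le> r / 2 ^ j"
proof (induction j)
  case (Suc j)
  then show ?case
    using next_ratio_le_half[OF ratio_pos[of r j]] by (simp add: ratio_Suc)
qed simp

text \<open>The value of \<open>a\<close> at site \<open>j\<close> of a solution with
  \<open>a 0 = 1\<close> and \<open>b 0 = r\<close>; the matching value of \<open>b\<close> is
  \<open>stake r j * ratio r j\<close>.\<close>

primrec stake :: "real \<Rightarrow> nat \<Rightarrow> real" where
  "stake r 0 = 1"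
| "stake r (Suc j) = stake r j * ratio r (Suc j) * (2 + ratio r j)"

lemma stake_pos: "0 < r \<Longrightarrow> 0 < stake r j"
  by (induction j) (auto intro!: mult_pos_pos ratio_pos add_pos_pos)

text \<open>For \<open>0 < r \<le> v\<close>, the bounds
  \<open>ratio r (Suc j) \<le> v / 2 ^ Suc j\<close> and \<open>ratio r j \<le> v\<close> control
  the growth factor of \<open>stake\<close> uniformly in \<open>r\<close>. The resulting factors
  tend to 0, so this majorant is summable.\<close>

primrec stake_bound :: "real \<Rightarrow> nat \<Rightarrow> real" where
  "stake_bound v 0 = 1"
| "stake_bound v (Suc j) = stake_bound v j * (v * (2 + v) / 2 ^ Suc j)"

lemma stake_bound_pos: "0 < v \<Longrightarrow> 0 < stake_bound v j"
  by (induction j) auto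

lemma summable_stake_bound:
  assumes "0 < v"
  shows "summable (stake_bound v)"
proof -
  have "(\<lambda>n. v * (2 + v) / 2 ^ Suc n) \<longlonglongrightarrow> 0"
    using LIMSEQ_Suc[OF LIMSEQ_divide_realpow_zero[of 2 "v * (2 + v)"]] by simp
  then have "\<forall>\<^sub>F n in sequentially. v * (2 + v) / 2 ^ Suc n < 1 / 2"
    by (rule order_tendstoD) simp
  then obtain N where N: "\<And>n. n \<ge> N \<Longrightarrow> v * (2 + v) / 2 ^ Suc n < 1 / 2"
    by (auto simp: eventually_sequentially)
  show ?thesis
  proof (rule summable_ratio_test[of "1/2" N])
    fix n assume "N \<le> n"
    then have "stake_bound v n * (v * (2 + v) / 2 ^ Suc n) \<le> stake_bound v n * (1 / 2)"
      using N[of n] stake_bound_pos[OF assms, of n] by (intro mult_left_mono) auto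
    then show "norm (stake_bound v (Suc n)) \<le> 1 / 2 * norm (stake_bound v n)"
      using stake_bound_pos[OF assms, of n] stake_bound_pos[OF assms, of "Suc n"] by simp
  qed simp
qed

lemma ratio_le_bound:
  assumes "0 < r" "r \<le> v"
  shows "ratio r j \<le> v / 2 ^ j" "ratio r j \<le> v"
proof -
  show *: "ratio r j \<le> v / 2 ^ j"
    using ratio_le[OF assms(1), of j] divide_right_mono[OF assms(2), of "2 ^ j"] by simp
  have "v / 2 ^ j \<le> v / 1"
    using assms by (intro divide_left_mono) auto
  with * show "ratio r j \<le> v" by simp
qed

lemma stake_le_bound:
  assumes "0 < r" "r \<le> v"
  shows "stake r j \<le> stake_bound v j"
proof (induction j)
  case (Suc j)
  have "ratio r (Suc j) * (2 + ratio r j) \<le> v / 2 ^ Suc j * (2 + v)"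
    using ratio_le_bound(1)[OF assms, of "Suc j"] ratio_le_bound(2)[OF assms, of j]
      ratio_pos[OF assms(1)] assms less_imp_le[OF ratio_pos[OF assms(1), of j]]
    by (intro mult_mono) auto
  then have "stake r j * (ratio r (Suc j) * (2 + ratio r j))
      \<le> stake_bound v j * (v / 2 ^ Suc j * (2 + v))"
    using assms less_imp_le[OF stake_bound_pos[of v j]] less_imp_le[OF ratio_pos[OF assms(1), of j]]
      less_imp_le[OF ratio_pos[OF assms(1), of "Suc j"]]
    by (intro mult_mono[OF Suc]) auto
  then show ?case by (simp add: mult.assoc)
qed simp

text \<open>Total rise of \<open>m\<close> to the right of site 0 when \<open>a 0 = 1\<close>: the
  sum of the increments \<open>2 * a + b\<close>. At \<open>1 / r\<close> it gives, by reflection,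
  the total drop of \<open>n\<close> on the left in units of \<open>b 0\<close>.\<close>

definition gain_sum :: "real \<Rightarrow> real" where
  "gain_sum r = (\<Sum>j. stake r j * (2 + ratio r j))"

text \<open>Total drop of \<open>n\<close> to the right of site 0 when \<open>a 0 = 1\<close>: the
  sum of \<open>b\<^sup>2 / a\<close>. At \<open>1 / r\<close> it gives the total rise of
  \<open>m\<close> on the left in units of \<open>b 0\<close>.\<close>

definition loss_sum :: "real \<Rightarrow> real" where
  "loss_sum r = (\<Sum>j. stake r j * (ratio r j)\<^sup>2)"

lemma gain_term_le:
  assumes "0 < r" "r \<le> v"
  shows "norm (stake r j * (2 + ratio r j)) \<le> stake_bound v j * (2 + v)"
proof -
  have "stake r j * (2 + ratio r j) \<le> stake_bound v j * (2 + v)"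
    using assms stake_le_bound[OF assms, of j] ratio_le_bound(2)[OF assms, of j]
      less_imp_le[OF stake_bound_pos[of v j]] less_imp_le[OF ratio_pos[OF assms(1), of j]]
    by (intro mult_mono) auto
  then show ?thesis
    using stake_pos[OF assms(1), of j] ratio_pos[OF assms(1), of j] by (simp add: abs_mult)
qed

lemma loss_term_le:
  assumes "0 < r" "r \<le> v"
  shows "norm (stake r j * (ratio r j)\<^sup>2) \<le> stake_bound v j * v\<^sup>2"
proof -
  have "stake r j * (ratio r j)\<^sup>2 \<le> stake_bound v j * v\<^sup>2"
    using assms stake_le_bound[OF assms, of j] ratio_le_bound(2)[OF assms, of j]
      less_imp_le[OF stake_bound_pos[of v j]] less_imp_le[OF ratio_pos[OF assms(1), of j]]
    by (intro mult_mono power_mono) auto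
  then show ?thesis
    using stake_pos[OF assms(1), of j] ratio_pos[OF assms(1), of j] by (simp add: abs_mult)
qed

lemma gain_sums: "0 < r \<Longrightarrow> (\<lambda>j. stake r j * (2 + ratio r j)) sums gain_sum r"
  unfolding gain_sum_def
  by (intro summable_sums summable_comparison_test'[where N = 0, OF summable_mult2[OF summable_stake_bound[of r], of "(2 + r)"]])
    (auto simp del: real_norm_def intro!: gain_term_le)

lemma loss_sums: "0 < r \<Longrightarrow> (\<lambda>j. stake r j * (ratio r j)\<^sup>2) sums loss_sum r"
  unfolding loss_sum_def
  by (intro summable_sums summable_comparison_test'[where N = 0, OF summable_mult2[OF summable_stake_bound[of r], of "r\<^sup>2"]])
    (auto simp del: real_norm_def intro!: loss_term_le)

lemma gain_sum_pos: "0 < r \<Longrightarrow> 0 < gain_sum r"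
  unfolding gain_sum_def
  by (rule suminf_pos) (auto intro!: sums_summable[OF gain_sums] mult_pos_pos stake_pos add_pos_pos ratio_pos)

lemma loss_sum_pos: "0 < r \<Longrightarrow> 0 < loss_sum r"
  unfolding loss_sum_def
  by (rule suminf_pos)
    (auto intro!: sums_summable[OF loss_sums] mult_pos_pos stake_pos ratio_pos zero_less_power)

section \<open>Continuity of the margin in the ratio\<close>

lemma continuous_on_ratio: "continuous_on {0<..v} (\<lambda>r. ratio r j)"
proof (induction j)
  case (Suc j)
  have "2 + ratio x j \<noteq> 0" if "x \<in> {0<..v}" for x
    using ratio_pos[of x j] that by simp
  then show ?case
    unfolding ratio_Suc next_ratio_def by (intro continuous_intros Suc) auto
qed (simp add: continuous_intros)

lemma continuous_on_stake: "continuous_on {0<..v} (\<lambda>r. stake r j)"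
  by (induction j) (auto intro!: continuous_intros continuous_on_ratio)

text \<open>Weierstrass M-test: the partial sums are continuous and converge uniformly.\<close>

lemma continuous_on_dominated_suminf:
  fixes f :: "'a::topological_space \<Rightarrow> nat \<Rightarrow> real"
  assumes "\<And>j. continuous_on S (\<lambda>x. f x j)"
    and "\<And>x j. x \<in> S \<Longrightarrow> norm (f x j) \<le> B j" and "summable B"
  shows "continuous_on S (\<lambda>x. \<Sum>j. f x j)"
proof (rule uniform_limit_theorem)
  show "uniform_limit S (\<lambda>n x. \<Sum>j<n. f x j) (\<lambda>x. \<Sum>j. f x j) sequentially"
    using Weierstrass_m_test[of S "\<lambda>j x. f x j" B] assms by simp
qed (auto intro!: always_eventually continuous_intros assms)

lemma continuous_on_gain_sum: "continuous_on {0<..v} gain_sum"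
proof (cases "0 < v")
  case True
  show ?thesis
    unfolding gain_sum_def
    by (rule continuous_on_dominated_suminf[where B = "\<lambda>j. stake_bound v j * (2 + v)"])
      (use gain_term_le True in \<open>auto intro!: continuous_intros continuous_on_ratio
        continuous_on_stake summable_mult2 summable_stake_bound\<close>)
qed auto

lemma continuous_on_loss_sum: "continuous_on {0<..v} loss_sum"
proof (cases "0 < v")
  case True
  show ?thesis
    unfolding loss_sum_def
    by (rule continuous_on_dominated_suminf[where B = "\<lambda>j. stake_bound v j * v\<^sup>2"])
      (use loss_term_le True in \<open>auto intro!: continuous_intros continuous_on_ratio
        continuous_on_stake summable_mult2 summable_stake_bound\<close>)
qed auto

text \<open>Total drop of \<open>n\<close> over total rise of \<open>m\<close>, both in units of
  \<open>a 0\<close>, when the ratio at site 0 is \<open>r\<close>. The factor \<open>r\<close>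
  converts the left half from units of \<open>b 0\<close>.\<close>

definition margin :: "real \<Rightarrow> real" where
  "margin r = (loss_sum r + r * gain_sum (1 / r)) / (gain_sum r + r * loss_sum (1 / r))"

lemma margin_pos: "0 < r \<Longrightarrow> 0 < margin r"
  unfolding margin_def
  by (intro divide_pos_pos add_pos_pos mult_pos_pos gain_sum_pos loss_sum_pos) auto

lemma continuous_on_margin: "continuous_on {1/5..1} margin"
proof -
  \<comment> \<open>On the window \<open>1 / r\<close> is at most \<open>5\<close>, so the reflected
    series stay in a range of uniform convergence.\<close>
  have inv: "continuous_on {1/5..1} (\<lambda>r. f (1 / r))" if "continuous_on {0<..5} f" for f :: "real \<Rightarrow> real"
    by (rule continuous_on_compose2[OF that]) (auto intro!: continuous_intros simp: field_simps)
  have nz: "gain_sum r + r * loss_sum (1 / r) \<noteq> 0" if "r \<in> {1/5..1}" for r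
  proof -
    have "0 < gain_sum r + r * loss_sum (1 / r)"
      using that by (intro add_pos_pos mult_pos_pos gain_sum_pos loss_sum_pos) auto
    then show ?thesis by simp
  qed
  show ?thesis
    unfolding margin_def
    using nz by (intro continuous_intros inv continuous_on_gain_sum continuous_on_loss_sum ballI
      continuous_on_subset[OF continuous_on_gain_sum[of 1]]
      continuous_on_subset[OF continuous_on_loss_sum[of 1]]) auto
qed

section \<open>Positive ABMN solutions\<close>

text \<open>For fixed stakes these are two linear equations in the increments \<open>v - vm\<close>
  and \<open>vp - v\<close>, solved explicitly. Mina's pair is the instance with \<open>a\<close>
  and \<open>b\<close>, and the two neighbours, exchanged.\<close>

lemma abmn_site_iff:
  fixes a b v vp vm :: real
  assumes "0 < a" "0 < b"
  shows "(a + b) * (v + a) = a * vp + b * vm \<and> (a + b)\<^sup>2 = b * (vp - vm) \<longleftrightarrow>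
    v - vm = a\<^sup>2 / b \<and> vp - v = 2 * a + b"
proof
  assume h: "(a + b) * (v + a) = a * vp + b * vm \<and> (a + b)\<^sup>2 = b * (vp - vm)"
  \<comment> \<open>The factor \<open>b\<close> allows \<open>b * (vp - vm)\<close> to be replaced
    by the square; one factor \<open>a + b\<close> then cancels.\<close>
  have "b * ((a + b) * (v - vm + a)) = b * ((a + b) * (v + a) - (a + b) * vm)"
    by (simp add: algebra_simps)
  also have "\<dots> = a * (b * (vp - vm))"
    using h by (simp add: algebra_simps)
  also have "\<dots> = a * (a + b)\<^sup>2"
    using h by simp
  finally have "(a + b) * (b * (v - vm + a)) = (a + b) * (a * (a + b))"
    by (simp add: power2_eq_square algebra_simps)
  then have *: "b * (v - vm + a) = a * (a + b)"
    using assms by simp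
  have 1: "v - vm = a\<^sup>2 / b"
    using * assms by (simp add: field_simps power2_eq_square)
  have "b * (vp - v) = (a + b)\<^sup>2 - b * (v - vm)"
    using h by (simp add: algebra_simps)
  also have "\<dots> = b * (2 * a + b)"
    using * by (simp add: algebra_simps power2_eq_square)
  finally show "v - vm = a\<^sup>2 / b \<and> vp - v = 2 * a + b"
    using 1 assms by simp
next
  assume h: "v - vm = a\<^sup>2 / b \<and> vp - v = 2 * a + b"
  then have vm: "vm = v - a\<^sup>2 / b" and vp: "vp = v + 2 * a + b" by auto
  show "(a + b) * (v + a) = a * vp + b * vm \<and> (a + b)\<^sup>2 = b * (vp - vm)"
    unfolding vm vp using assms by (simp add: field_simps power2_eq_square)
qed

lemma positive_ABMN_iff:
  "positive_ABMN a b m n \<longleftrightarrow> (\<forall>i. 0 < a i \<and> 0 < b i \<and>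
     m i - m (i - 1) = (a i)\<^sup>2 / b i \<and> m (i + 1) - m i = 2 * a i + b i \<and>
     n i - n (i + 1) = (b i)\<^sup>2 / a i \<and> n (i - 1) - n i = 2 * b i + a i)"
proof -
  have "0 < a i \<and> 0 < b i \<and> 0 \<le> a i \<and> 0 \<le> b i \<and>
        (a i + b i) * (m i + a i) = a i * m (i + 1) + b i * m (i - 1) \<and>
        (a i + b i) * (n i + b i) = a i * n (i + 1) + b i * n (i - 1) \<and>
        (a i + b i)^2 = b i * (m (i + 1) - m (i - 1)) \<and>
        (a i + b i)^2 = a i * (n (i - 1) - n (i + 1)) \<longleftrightarrow>
     0 < a i \<and> 0 < b i \<and>
     m i - m (i - 1) = (a i)\<^sup>2 / b i \<and> m (i + 1) - m i = 2 * a i + b i \<and>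
     n i - n (i + 1) = (b i)\<^sup>2 / a i \<and> n (i - 1) - n i = 2 * b i + a i" for i
  proof (cases "0 < a i \<and> 0 < b i")
    case True
    then show ?thesis
      using abmn_site_iff[of "a i" "b i" "m i" "m (i + 1)" "m (i - 1)"]
        abmn_site_iff[of "b i" "a i" "n i" "n (i - 1)" "n (i + 1)"]
      by (auto simp only: add.commute[of "b i" "a i"]
          add.commute[of "b i * n (i - 1)" "a i * n (i + 1)"] less_imp_le)
  qed auto
  then show ?thesis
    unfolding positive_ABMN_def ABMN_solution_def by (smt (verit))
qed

section \<open>Symmetries of the system\<close>

lemma positive_ABMN_reflect:
  assumes "positive_ABMN a b m n"
  shows "positive_ABMN (\<lambda>i. b (- i)) (\<lambda>i. a (- i)) (\<lambda>i. n (- i)) (\<lambda>i. m (- i))"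
  unfolding positive_ABMN_iff
proof
  fix i :: int
  have "- (i - 1) = - i + 1" "- (i + 1) = - i - 1" by simp_all
  then show "0 < b (- i) \<and> 0 < a (- i) \<and>
     n (- i) - n (- (i - 1)) = (b (- i))\<^sup>2 / a (- i) \<and> n (- (i + 1)) - n (- i) = 2 * b (- i) + a (- i) \<and>
     m (- i) - m (- (i + 1)) = (a (- i))\<^sup>2 / b (- i) \<and> m (- (i - 1)) - m (- i) = 2 * a (- i) + b (- i)"
    using assms[unfolded positive_ABMN_iff, rule_format, of "- i"] by simp
qed

lemma positive_ABMN_shift:
  assumes "positive_ABMN a b m n"
  shows "positive_ABMN (\<lambda>i. a (i + k)) (\<lambda>i. b (i + k)) (\<lambda>i. m (i + k)) (\<lambda>i. n (i + k))"
  unfolding positive_ABMN_iff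
proof
  fix i :: int
  have e: "i - 1 + k = i + k - 1" "i + 1 + k = i + k + 1" by simp_all
  show "0 < a (i + k) \<and> 0 < b (i + k) \<and>
     m (i + k) - m (i - 1 + k) = (a (i + k))\<^sup>2 / b (i + k) \<and>
     m (i + 1 + k) - m (i + k) = 2 * a (i + k) + b (i + k) \<and>
     n (i + k) - n (i + 1 + k) = (b (i + k))\<^sup>2 / a (i + k) \<and>
     n (i - 1 + k) - n (i + k) = 2 * b (i + k) + a (i + k)"
    unfolding e using assms[unfolded positive_ABMN_iff, rule_format, of "i + k"] by simp
qed

text \<open>The increments are homogeneous of degree one in the stakes, and \<open>m\<close> and
  \<open>n\<close> enter through differences only, so each may be translated separately.\<close>

lemma positive_ABMN_scale:
  assumes "positive_ABMN a b m n" "0 < c"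
  shows "positive_ABMN (\<lambda>i. c * a i) (\<lambda>i. c * b i) (\<lambda>i. c * (m i - d)) (\<lambda>i. c * (n i - e))"
  unfolding positive_ABMN_iff
proof
  fix i :: int
  have d: "c * (x - z) - c * (y - z) = c * (x - y)" for x y z
    by (simp add: algebra_simps)
  have q: "(c * x)\<^sup>2 / (c * y) = c * (x\<^sup>2 / y)" for x y
    using assms(2) by (simp add: power2_eq_square)
  show "0 < c * a i \<and> 0 < c * b i \<and>
     c * (m i - d) - c * (m (i - 1) - d) = (c * a i)\<^sup>2 / (c * b i) \<and>
     c * (m (i + 1) - d) - c * (m i - d) = 2 * (c * a i) + c * b i \<and>
     c * (n i - e) - c * (n (i + 1) - e) = (c * b i)\<^sup>2 / (c * a i) \<and>
     c * (n (i - 1) - e) - c * (n i - e) = 2 * (c * b i) + c * a i"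
    unfolding d q
    using assms(1)[unfolded positive_ABMN_iff, rule_format, of i] assms(2)
    by (simp add: algebra_simps)
qed

text \<open>Primes mark the right neighbour. The increments of \<open>m\<close> and \<open>n\<close>
  across the edge between the two sites can each be computed from either end; equating the two
  expressions gives the recursion.\<close>

lemma stake_recursion:
  fixes a b a' b' :: real
  assumes "0 < a" "0 < b" "0 < a'" "0 < b'"
    and m: "2 * a + b = a'\<^sup>2 / b'" and n: "b\<^sup>2 / a = 2 * b' + a'"
  shows "a' = a * (b' / a') * (2 + b / a)" and "b' / a' = next_ratio (b / a)"
proof -
  have m': "(2 * a + b) * b' = a' * a'"
    using m assms by (simp add: field_simps power2_eq_square)
  have n': "b * b = (2 * b' + a') * a"
    using n assms by (simp add: field_simps power2_eq_square)
  have "a * (b' / a') * (2 + b / a) = (2 * a + b) * b' / a'"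
    using assms by (simp add: field_simps)
  then show "a' = a * (b' / a') * (2 + b / a)"
    using m' assms by simp
  show "b' / a' = next_ratio (b / a)"
  proof (rule next_ratio_unique)
    have "b' / a' * (1 + 2 * (b' / a')) = b' * (a' + 2 * b') / (a' * a')"
      using assms by (simp add: field_simps)
    also have "\<dots> = b' * (a' + 2 * b') / ((2 * a + b) * b')"
      by (simp add: m')
    also have "\<dots> = (a' + 2 * b') / (2 * a + b)"
      using assms by simp
    also have "\<dots> = (a' + 2 * b') * a / ((2 * a + b) * a)"
      using assms by simp
    also have "\<dots> = b * b / ((2 * a + b) * a)"
      using n' by (simp add: algebra_simps)
    also have "\<dots> = (b / a)\<^sup>2 / (2 + b / a)"
      using assms(1,2) by (simp add: field_simps power2_eq_square)
    finally show "b' / a' * (1 + 2 * (b' / a')) = (b / a)\<^sup>2 / (2 + b / a)" .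
  qed (use assms in auto)
qed

lemma positive_ABMN_step:
  assumes "positive_ABMN a b m n"
  shows "a (i + 1) = a i * (b (i + 1) / a (i + 1)) * (2 + b i / a i)"
    and "b (i + 1) / a (i + 1) = next_ratio (b i / a i)"
proof -
  note h = assms[unfolded positive_ABMN_iff, rule_format]
  have "2 * a i + b i = (a (i + 1))\<^sup>2 / b (i + 1)" "(b i)\<^sup>2 / a i = 2 * b (i + 1) + a (i + 1)"
    using h[of i] h[of "i + 1"] by simp_all
  then show "a (i + 1) = a i * (b (i + 1) / a (i + 1)) * (2 + b i / a i)"
    "b (i + 1) / a (i + 1) = next_ratio (b i / a i)"
    using stake_recursion h[of i] h[of "i + 1"] by blast+
qed

lemma positive_ABMN_forward:
  assumes "positive_ABMN a b m n"
  shows "b (int j) / a (int j) = ratio (b 0 / a 0) j \<and> a (int j) = a 0 * stake (b 0 / a 0) j"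
proof (induction j)
  case (Suc j)
  then have r: "b (int j) / a (int j) = ratio (b 0 / a 0) j"
    and a: "a (int j) = a 0 * stake (b 0 / a 0) j" by auto
  have i: "int (Suc j) = int j + 1" by simp
  have r': "b (int (Suc j)) / a (int (Suc j)) = ratio (b 0 / a 0) (Suc j)"
    unfolding i ratio_Suc r[symmetric] by (rule positive_ABMN_step(2)[OF assms])
  have "a (int (Suc j)) = a (int j) * (b (int (Suc j)) / a (int (Suc j))) * (2 + b (int j) / a (int j))"
    unfolding i by (rule positive_ABMN_step(1)[OF assms])
  then have "a (int (Suc j)) = a 0 * stake (b 0 / a 0) (Suc j)"
    unfolding r r' unfolding a by (simp add: mult.assoc)
  with r' show ?case by blast
qed simp

section \<open>Limits at infinity and the margin\<close>

lemma tendsto_int_at_bot_iff: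
  fixes f :: "int \<Rightarrow> 'a::topological_space"
  shows "(f \<longlongrightarrow> L) at_bot \<longleftrightarrow> ((\<lambda>i. f (- i)) \<longlongrightarrow> L) at_top"
  unfolding filterlim_def at_bot_mirror filtermap_filtermap ..

text \<open>The increments telescope into partial sums of the two series, scaled by
  \<open>a 0\<close>.\<close>

lemma positive_ABMN_tendsto_at_top:
  assumes "positive_ABMN a b m n"
  shows "(m \<longlongrightarrow> m 0 + a 0 * gain_sum (b 0 / a 0)) at_top"
    and "(n \<longlongrightarrow> n 0 - a 0 * loss_sum (b 0 / a 0)) at_top"
proof -
  let ?r = "b 0 / a 0"
  note h = assms[unfolded positive_ABMN_iff, rule_format]
  have r: "0 < ?r" using h[of 0] by simp
  have a: "a (int j) = a 0 * stake ?r j" and b: "b (int j) = a 0 * stake ?r j * ratio ?r j" for j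
    using positive_ABMN_forward[OF assms, of j] h[of "int j"] by (auto simp: field_simps)
  have pos: "a 0 * stake ?r j \<noteq> 0" for j
    using h[of 0] stake_pos[OF r, of j] by simp
  have "m (int (Suc j)) - m (int j) = a 0 * (stake ?r j * (2 + ratio ?r j))" for j
    using h[of "int j"] a[of j] b[of j] by (simp add: algebra_simps)
  then have "m (int k) = m 0 + (\<Sum>j<k. a 0 * (stake ?r j * (2 + ratio ?r j)))" for k
    using sum_lessThan_telescope[of "\<lambda>j. m (int j)" k] by simp
  moreover have "(\<lambda>j. a 0 * (stake ?r j * (2 + ratio ?r j))) sums (a 0 * gain_sum ?r)"
    using gain_sums[OF r] by (rule sums_mult)
  ultimately have "(\<lambda>k. m (int k)) \<longlonglongrightarrow> m 0 + a 0 * gain_sum ?r"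
    unfolding sums_def by (simp add: tendsto_intros)
  then show "(m \<longlongrightarrow> m 0 + a 0 * gain_sum ?r) at_top"
    by (rule filterlim_int_of_nat_at_topD)
  have "n (int j) - n (int (Suc j)) = a 0 * (stake ?r j * (ratio ?r j)\<^sup>2)" for j
  proof -
    have "n (int j) - n (int (Suc j)) = (b (int j))\<^sup>2 / a (int j)"
      using h[of "int j"] by (simp add: add.commute)
    also have "\<dots> = a 0 * (stake ?r j * (ratio ?r j)\<^sup>2)"
      unfolding a b using pos[of j] by (simp add: power2_eq_square)
    finally show ?thesis .
  qed
  then have "n (int k) = n 0 - (\<Sum>j<k. a 0 * (stake ?r j * (ratio ?r j)\<^sup>2))" for k
    using sum_lessThan_telescope'[of "\<lambda>j. n (int j)" k] by simp
  moreover have "(\<lambda>j. a 0 * (stake ?r j * (ratio ?r j)\<^sup>2)) sums (a 0 * loss_sum ?r)"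
    using loss_sums[OF r] by (rule sums_mult)
  ultimately have "(\<lambda>k. n (int k)) \<longlonglongrightarrow> n 0 - a 0 * loss_sum ?r"
    unfolding sums_def by (simp add: tendsto_intros)
  then show "(n \<longlongrightarrow> n 0 - a 0 * loss_sum ?r) at_top"
    by (rule filterlim_int_of_nat_at_topD)
qed

lemma positive_ABMN_tendsto_at_bot:
  assumes "positive_ABMN a b m n"
  shows "(m \<longlongrightarrow> m 0 - b 0 * loss_sum (a 0 / b 0)) at_bot"
    and "(n \<longlongrightarrow> n 0 + b 0 * gain_sum (a 0 / b 0)) at_bot"
  using positive_ABMN_tendsto_at_top[OF positive_ABMN_reflect[OF assms]]
  by (simp_all add: tendsto_int_at_bot_iff)

lemma positive_ABMN_margin:
  assumes s: "positive_ABMN a b m n"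
    and "(m \<longlongrightarrow> mL) at_bot" "(m \<longlongrightarrow> mR) at_top" "(n \<longlongrightarrow> nL) at_bot" "(n \<longlongrightarrow> nR) at_top"
  shows "(nL - nR) / (mR - mL) = margin (b 0 / a 0)" and "mL < mR" and "nR < nL"
proof -
  have pos: "0 < a 0" "0 < b 0"
    using s by (auto simp: positive_ABMN_iff)
  have eq: "mL = m 0 - b 0 * loss_sum (a 0 / b 0)" "mR = m 0 + a 0 * gain_sum (b 0 / a 0)"
    "nL = n 0 + b 0 * gain_sum (a 0 / b 0)" "nR = n 0 - a 0 * loss_sum (b 0 / a 0)"
    using assms positive_ABMN_tendsto_at_top[OF s] positive_ABMN_tendsto_at_bot[OF s]
    by (auto intro: tendsto_unique[rotated])
  have "0 < a 0 * gain_sum (b 0 / a 0)" "0 < a 0 * loss_sum (b 0 / a 0)"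
    "0 < b 0 * gain_sum (a 0 / b 0)" "0 < b 0 * loss_sum (a 0 / b 0)"
    using pos by (auto intro!: mult_pos_pos gain_sum_pos loss_sum_pos)
  then show "mL < mR" "nR < nL" unfolding eq by auto
  have "nL - nR = a 0 * (loss_sum (b 0 / a 0) + b 0 / a 0 * gain_sum (1 / (b 0 / a 0)))"
    "mR - mL = a 0 * (gain_sum (b 0 / a 0) + b 0 / a 0 * loss_sum (1 / (b 0 / a 0)))"
    unfolding eq using pos by (simp_all add: distrib_left)
  then show "(nL - nR) / (mR - mL) = margin (b 0 / a 0)"
    unfolding margin_def using pos by simp
qed

text \<open>The ratio at least halves with each step to the right, so it exceeds 1 far to the left
  and there is a first later site where it is at most 1. The ratio \<open>r\<close> just before
  exceeds 1, so \<open>r\<^sup>2 / (2 + r) \<ge> 1/3\<close>, which is more than the value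
  \<open>7/25\<close> of the quadratic at \<open>1/5\<close>.\<close>

lemma positive_ABMN_ratio_window:
  assumes s: "positive_ABMN a b m n"
  shows "\<exists>i. b i / a i \<in> {1/5..1}"
proof -
  define r where "r i = b i / a i" for i
  have rpos: "0 < r i" for i
    using s by (auto simp: positive_ABMN_iff r_def)
  have step: "r (i + 1) = next_ratio (r i)" for i
    unfolding r_def by (rule positive_ABMN_step(2)[OF s])
  have half: "r (i + 1) \<le> r i / 2" for i
    using next_ratio_le_half[OF rpos[of i]] by (simp add: step)
  have up: "r (- int j) \<ge> 2 ^ j * r 0" for j
  proof (induction j)
    case (Suc j)
    then show ?case using half[of "- int (Suc j)"] by simp
  qed simp
  have down: "r (i + int j) \<le> r i / 2 ^ j" for i j
  proof (induction j)
    case (Suc j)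
    then show ?case using half[of "i + int j"] by (simp add: algebra_simps)
  qed simp
  obtain J where "1 / r 0 < 2 ^ J"
    using real_arch_pow[of 2 "1 / r 0"] by auto
  then have J: "1 < r (- int J)"
    using up[of J] rpos[of 0] by (simp add: field_simps)
  obtain K where "r (- int J) < 2 ^ K"
    using real_arch_pow[of 2 "r (- int J)"] by auto
  then have "r (- int J + int K) \<le> 1"
    using order_trans[OF down[of "- int J" K], of 1] by simp
  then have ex: "\<exists>k. r (- int J + int k) \<le> 1" by blast
  define k where "k = (LEAST k. r (- int J + int k) \<le> 1)"
  have k: "r (- int J + int k) \<le> 1"
    unfolding k_def using ex by (rule LeastI_ex)
  \<comment> \<open>The search starts at site \<open>- int J\<close>, where the ratio exceeds 1, so
    the site found has a predecessor within the search.\<close>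
  have "k \<noteq> 0" using k J by (auto intro: ccontr)
  then obtain l where l: "k = Suc l" by (cases k) auto
  define i where "i = - int J + int l"
  have "\<not> r i \<le> 1"
    unfolding i_def using not_less_Least[of l "\<lambda>k. r (- int J + int k) \<le> 1"] l k_def by simp
  then have i: "1 < r i" by simp
  have i1: "r (i + 1) \<le> 1" using k by (simp add: l i_def algebra_simps)
  have "1/5 \<le> r (i + 1)"
  proof (rule ratio_quadratic_mono)
    have "1/3 \<le> (r i)\<^sup>2 / (2 + r i)"
    proof -
      have "2 + r i \<le> 3 * (r i * r i)"
        using i less_1_mult[OF i i] mult_strict_left_mono[OF i, of "r i"] by linarith
      then show ?thesis
        using i by (simp add: field_simps power2_eq_square)
    qed
    then show "1/5 * (1 + 2 * (1/5)) \<le> r (i + 1) * (1 + 2 * r (i + 1))"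
      using next_ratio_eq[OF rpos[of i]] by (simp add: step)
  qed (use rpos[of "i + 1"] in auto)
  with i1 show ?thesis
    unfolding r_def by auto
qed

text \<open>Converse of \<open>stake_recursion\<close>: sequences generated from one ratio satisfy
  both compatibility conditions across every edge.\<close>

lemma ratio_step:
  assumes "0 < r"
  defines "a \<equiv> stake r" and "b \<equiv> \<lambda>j. stake r j * ratio r j"
  shows "(a (Suc j))\<^sup>2 / b (Suc j) = 2 * a j + b j"
    and "2 * b (Suc j) + a (Suc j) = (b j)\<^sup>2 / a j"
proof -
  define s where "s = ratio r j"
  define t where "t = ratio r (Suc j)"
  have pos: "0 < stake r j" "0 < s" "0 < t"
    using assms(1) by (auto simp: s_def t_def intro: stake_pos ratio_pos)
  have t: "t * (1 + 2 * t) = s\<^sup>2 / (2 + s)"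
    unfolding s_def t_def ratio_Suc by (rule next_ratio_eq[OF ratio_pos[OF assms(1)]])
  show "(a (Suc j))\<^sup>2 / b (Suc j) = 2 * a j + b j"
    unfolding a_def b_def stake.simps s_def[symmetric] t_def[symmetric]
    by (rule nonzero_divide_eq_eq[THEN iffD2])
      (use pos in \<open>simp_all add: power2_eq_square algebra_simps add_pos_pos less_imp_neq[symmetric]\<close>)
  have "2 * b (Suc j) + a (Suc j) = stake r j * (2 + s) * (t * (1 + 2 * t))"
    unfolding a_def b_def stake.simps s_def[symmetric] t_def[symmetric]
    by (simp add: algebra_simps)
  also have "\<dots> = stake r j * s\<^sup>2"
    unfolding t using pos by simp
  also have "\<dots> = (b j)\<^sup>2 / a j"
    unfolding a_def b_def s_def[symmetric] using pos by (simp add: power2_eq_square)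
  finally show "2 * b (Suc j) + a (Suc j) = (b j)\<^sup>2 / a j" .
qed

text \<open>The right half is generated by \<open>r\<close>; the left half is the reflection of the
  sequence generated by \<open>1 / r\<close>, scaled by \<open>r\<close>. Summing the prescribed
  increments from the value 0 at site 0 defines \<open>m\<close> and \<open>n\<close>.\<close>

lemma positive_ABMN_exists:
  assumes r: "0 < r"
  obtains a b m n where "positive_ABMN a b m n" "b 0 / a 0 = r"
proof -
  have r': "0 < 1 / r" using r by simp
  define a where "a i = (if 0 \<le> i then stake r (nat i)
    else r * (stake (1 / r) (nat (- i)) * ratio (1 / r) (nat (- i))))" for i
  define b where "b i = (if 0 \<le> i then stake r (nat i) * ratio r (nat i)
    else r * stake (1 / r) (nat (- i)))" for i
  define m where "m i = (if 0 \<le> i then (\<Sum>j<nat i. 2 * a (int j) + b (int j))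
    else - (\<Sum>j<nat (- i). (a (- int j))\<^sup>2 / b (- int j)))" for i
  define n where "n i = (if 0 \<le> i then - (\<Sum>j<nat i. (b (int j))\<^sup>2 / a (int j))
    else (\<Sum>j<nat (- i). 2 * b (- int j) + a (- int j)))" for i
  have a_fwd: "a (int j) = stake r j" and b_fwd: "b (int j) = stake r j * ratio r j" for j
    by (simp_all add: a_def b_def)
  \<comment> \<open>At \<open>j = 0\<close> both branches give \<open>a 0 = 1\<close> and
    \<open>b 0 = r\<close>, so the two halves fit together.\<close>
  have a_bwd: "a (- int j) = r * (stake (1 / r) j * ratio (1 / r) j)"
    and b_bwd: "b (- int j) = r * stake (1 / r) j" for j
  proof -
    have j: "nat (- (- int j)) = j" "0 \<le> - int j \<longleftrightarrow> j = 0" by simp_all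
    show "a (- int j) = r * (stake (1 / r) j * ratio (1 / r) j)"
      unfolding a_def j using r by (cases "j = 0") simp_all
    show "b (- int j) = r * stake (1 / r) j"
      unfolding b_def j using r by (cases "j = 0") simp_all
  qed
  have pos: "0 < a i" "0 < b i" for i
    using r by (auto simp: a_def b_def intro!: mult_pos_pos stake_pos ratio_pos)
  have sq: "(r * x)\<^sup>2 / (r * y) = r * (x\<^sup>2 / y)" for x y
    using r by (simp add: power2_eq_square)
  have fwd: "(a (int (Suc j)))\<^sup>2 / b (int (Suc j)) = 2 * a (int j) + b (int j)"
    "2 * b (int (Suc j)) + a (int (Suc j)) = (b (int j))\<^sup>2 / a (int j)" for j
    unfolding a_fwd b_fwd by (rule ratio_step[OF r])+
  have bwd1: "(b (- int (Suc j)))\<^sup>2 / a (- int (Suc j)) = 2 * b (- int j) + a (- int j)" for j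
    unfolding a_bwd b_bwd sq ratio_step(1)[OF r'] by (simp only: algebra_simps)
  have bwd2: "2 * a (- int (Suc j)) + b (- int (Suc j)) = (a (- int j))\<^sup>2 / b (- int j)" for j
    unfolding a_bwd b_bwd sq ratio_step(2)[OF r', symmetric] by (simp only: algebra_simps)
  have m_fwd: "m (int j) = (\<Sum>j<j. 2 * a (int j) + b (int j))"
    and n_fwd: "n (int j) = - (\<Sum>j<j. (b (int j))\<^sup>2 / a (int j))"
    and m_bwd: "m (- int j) = - (\<Sum>j<j. (a (- int j))\<^sup>2 / b (- int j))"
    and n_bwd: "n (- int j) = (\<Sum>j<j. 2 * b (- int j) + a (- int j))" for j
    unfolding m_def n_def by (cases "j = 0"; simp)+
  have up: "m (i + 1) - m i = 2 * a i + b i \<and> n i - n (i + 1) = (b i)\<^sup>2 / a i" for i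
  proof (cases "0 \<le> i")
    case True
    then obtain j where i: "i = int j" using nonneg_int_cases by blast
    have "i + 1 = int (Suc j)" using i by simp
    then show ?thesis
      unfolding i by (simp only: m_fwd n_fwd sum.lessThan_Suc) simp
  next
    case False
    then obtain j where i: "i = - int (Suc j)"
      by (metis int_cases of_nat_0_le_iff)
    have "i + 1 = - int j" using i by simp
    then show ?thesis
      unfolding i by (simp only: m_bwd n_bwd sum.lessThan_Suc bwd1 bwd2) simp
  qed
  have down: "m i - m (i - 1) = (a i)\<^sup>2 / b i \<and> n (i - 1) - n i = 2 * b i + a i" for i
  proof (cases "i \<le> 0")
    case True
    then obtain j where i: "i = - int j" using nonpos_int_cases by blast
    have "i - 1 = - int (Suc j)" using i by simp
    then show ?thesis
      unfolding i by (simp only: m_bwd n_bwd sum.lessThan_Suc) simp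
  next
    case False
    then obtain j where i: "i = int (Suc j)"
      by (metis not_less pos_int_cases Suc_diff_1)
    have "i - 1 = int j" using i by simp
    then show ?thesis
      unfolding i by (simp only: m_fwd n_fwd sum.lessThan_Suc fwd) simp
  qed
  have "positive_ABMN a b m n"
    unfolding positive_ABMN_iff using pos up down by blast
  moreover have "b 0 / a 0 = r"
    using a_fwd[of 0] b_fwd[of 0] by simp
  ultimately show ?thesis by (rule that)
qed

section \<open>The set of Mina margins\<close>

lemma mina_margins_eq_image: "mina_margins = margin ` {1/5..1}"
proof (intro equalityI subsetI)
  fix x assume "x \<in> mina_margins"
  then obtain a b m n mL mR nL nR where x: "x = (nL - nR) / (mR - mL)"
    and s: "positive_ABMN a b m n"
    and lim: "(m \<longlongrightarrow> mL) at_bot" "(m \<longlongrightarrow> mR) at_top" "(n \<longlongrightarrow> nL) at_bot" "(n \<longlongrightarrow> nR) at_top"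
    unfolding mina_margins_def by blast
  \<comment> \<open>Translation leaves the limits unchanged, so the origin may be moved to a site
    whose ratio lies in the window.\<close>
  obtain i where i: "b i / a i \<in> {1/5..1}"
    using positive_ABMN_ratio_window[OF s] by blast
  have shift: "filterlim (\<lambda>j. j + i) at_top at_top" "filterlim (\<lambda>j. j + i) at_bot at_bot"
    unfolding filterlim_at_top filterlim_at_bot
    by (metis add.commute diff_le_eq eventually_at_top_linorder,
        metis add.commute le_diff_eq eventually_at_bot_linorder)
  have "x = margin (b (0 + i) / a (0 + i))"
    unfolding x
    by (rule positive_ABMN_margin(1)[OF positive_ABMN_shift[OF s]])
      (use lim shift in \<open>auto intro: filterlim_compose\<close>)
  with i show "x \<in> margin ` {1/5..1}" by auto
next
  fix x assume "x \<in> margin ` {1/5..1}"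
  then obtain r where "r \<in> {1/5..1}" and x: "x = margin r" by blast
  then have r: "0 < r" by simp
  obtain a b m n where s: "positive_ABMN a b m n" and r0: "b 0 / a 0 = r"
    using positive_ABMN_exists[OF r] .
  note lim = positive_ABMN_tendsto_at_bot[OF s] positive_ABMN_tendsto_at_top[OF s]
  show "x \<in> mina_margins"
    unfolding mina_margins_def x r0[symmetric]
    using s lim positive_ABMN_margin(1)[OF s lim(1,3,2,4), symmetric] by blast
qed

lemma mina_margins_inverse:
  assumes "x \<in> mina_margins"
  shows "1 / x \<in> mina_margins"
proof -
  obtain a b m n mL mR nL nR where x: "x = (nL - nR) / (mR - mL)"
    and s: "positive_ABMN a b m n"
    and lim: "(m \<longlongrightarrow> mL) at_bot" "(m \<longlongrightarrow> mR) at_top" "(n \<longlongrightarrow> nL) at_bot" "(n \<longlongrightarrow> nR) at_top"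
    using assms unfolding mina_margins_def by blast
  have "1 / x = (mR - mL) / (nL - nR)"
    using positive_ABMN_margin(2,3)[OF s lim] by (simp add: x)
  moreover have "((\<lambda>i. n (- i)) \<longlongrightarrow> nR) at_bot" "((\<lambda>i. n (- i)) \<longlongrightarrow> nL) at_top"
    "((\<lambda>i. m (- i)) \<longlongrightarrow> mR) at_bot" "((\<lambda>i. m (- i)) \<longlongrightarrow> mL) at_top"
    using lim by (simp_all add: tendsto_int_at_bot_iff)
  ultimately show ?thesis
    unfolding mina_margins_def using positive_ABMN_reflect[OF s] by blast
qed

text \<open>Compactness makes the infimum a margin, inversion makes its reciprocal the maximum, and
  connectedness fills the interval between them.\<close>

lemma mina_margins_eq: "mina_margins = {lambda_ABMN .. 1 / lambda_ABMN}"
proof -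
  have compact: "compact mina_margins" and connected: "connected mina_margins"
    unfolding mina_margins_eq_image
    using continuous_on_margin by (auto intro: compact_continuous_image connected_continuous_image)
  have pos: "0 < x" if "x \<in> mina_margins" for x
    using that margin_pos by (auto simp: mina_margins_eq_image)
  have ne: "mina_margins \<noteq> {}" by (simp add: mina_margins_eq_image)
  have bdd: "bdd_below mina_margins"
    using pos by (intro bdd_belowI[of _ 0]) (auto intro: less_imp_le)
  have lam: "lambda_ABMN \<in> mina_margins"
    unfolding lambda_ABMN_def
    using closed_contains_Inf[OF ne bdd compact_imp_closed[OF compact]] .
  have le: "lambda_ABMN \<le> x" if "x \<in> mina_margins" for x
    unfolding lambda_ABMN_def using that bdd by (rule cInf_lower)
  have "x \<le> 1 / lambda_ABMN" if "x \<in> mina_margins" for x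
    using le[OF mina_margins_inverse[OF that]] pos[OF that] pos[OF lam]
    by (simp add: field_simps)
  then show ?thesis
    using le connected_contains_Icc[OF connected lam mina_margins_inverse[OF lam]] by auto
qed

text \<open>One common scaling makes the rise of \<open>m\<close> equal to 1; separate translations
  send \<open>mL\<close> and \<open>nR\<close> to 0, and the margin is what remains of
  \<open>nL\<close>.\<close>

lemma standard_ABMN_exists:
  assumes "x \<in> mina_margins"
  obtains a b m n where "positive_ABMN a b m n"
    "(m \<longlongrightarrow> 0) at_bot" "(m \<longlongrightarrow> 1) at_top" "(n \<longlongrightarrow> x) at_bot" "(n \<longlongrightarrow> 0) at_top"
proof -
  obtain a b m n mL mR nL nR where x: "x = (nL - nR) / (mR - mL)"
    and s: "positive_ABMN a b m n"
    and lim: "(m \<longlongrightarrow> mL) at_bot" "(m \<longlongrightarrow> mR) at_top" "(n \<longlongrightarrow> nL) at_bot" "(n \<longlongrightarrow> nR) at_top"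
    using assms unfolding mina_margins_def by blast
  define c where "c = 1 / (mR - mL)"
  have c: "0 < c" "c * (mR - mL) = 1" "c * (nL - nR) = x"
    using positive_ABMN_margin(2)[OF s lim] by (simp_all add: c_def x)
  have "((\<lambda>i. c * (m i - mL)) \<longlongrightarrow> c * (mL - mL)) at_bot"
    "((\<lambda>i. c * (m i - mL)) \<longlongrightarrow> c * (mR - mL)) at_top"
    "((\<lambda>i. c * (n i - nR)) \<longlongrightarrow> c * (nL - nR)) at_bot"
    "((\<lambda>i. c * (n i - nR)) \<longlongrightarrow> c * (nR - nR)) at_top"
    by (intro tendsto_intros lim)+
  then show ?thesis
    using that[OF positive_ABMN_scale[OF s c(1), of mL nR]] c by simp
qed

section \<open>Random play\<close>

abbreviation unif :: "real measure" where
  "unif \<equiv> uniform_measure lborel {0..1}"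

lemma prob_space_unif: "prob_space unif"
  by (rule prob_space_uniform_measure) auto

interpretation unif_seq: sequence_space unif
proof -
  interpret prob_space unif by (rule prob_space_unif)
  show "sequence_space unif" by unfold_locales
qed

interpretation noise: prob_space noise
  unfolding noise_def by (rule prob_space_PiM) (rule prob_space_unif)

lemma measurable_noise_component: "(\<lambda>\<omega>. \<omega> n) \<in> borel_measurable noise"
proof -
  have "(\<lambda>\<omega>. \<omega> n) \<in> noise \<rightarrow>\<^sub>M unif"
    unfolding noise_def by (rule measurable_component_singleton) simp
  then show ?thesis by (simp cong: measurable_cong_sets)
qed

abbreviation paths :: "(nat \<Rightarrow> int) measure" where
  "paths \<equiv> PiM UNIV (\<lambda>_. count_space UNIV)"

lemma measurable_gameplay_at [measurable]:
  "(\<lambda>\<omega>. gameplay Sm Sp k \<omega> n) \<in> noise \<rightarrow>\<^sub>M count_space UNIV"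
proof (induction n)
  case (Suc n)
  note [measurable] = Suc measurable_noise_component[of n]
  show ?case unfolding gameplay.simps by measurable
qed simp

lemma measurable_gameplay [measurable]: "gameplay Sm Sp k \<in> noise \<rightarrow>\<^sub>M paths"
  by (rule measurable_PiM_single') (auto simp: measurable_gameplay_at space_PiM)

definition later :: "(int \<Rightarrow> nat \<Rightarrow> real) \<Rightarrow> int \<Rightarrow> nat \<Rightarrow> real" where
  "later S i t = S i (Suc t)"

lemma strategy_later: "strategy S \<Longrightarrow> strategy (later S)"
  by (simp add: strategy_def later_def)

text \<open>Removing the first uniform variable leaves the gameplay of the time-shifted strategies,
  started from the position after one turn.\<close>

lemma gameplay_case_nat:
  "gameplay Sm Sp k (case_nat s \<omega>) = case_nat k
     (gameplay (later Sm) (later Sp) (if s < up_prob Sm Sp k 1 then k + 1 else k - 1) \<omega>)"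
proof
  fix n
  show "gameplay Sm Sp k (case_nat s \<omega>) n = case_nat k
     (gameplay (later Sm) (later Sp) (if s < up_prob Sm Sp k 1 then k + 1 else k - 1) \<omega>) n"
  proof (induction n)
    case (Suc n)
    then show ?case
      by (cases n) (simp_all add: later_def up_prob_def)
  qed simp
qed

lemma up_prob_bounds:
  assumes "strategy Sm" "strategy Sp"
  shows "0 \<le> up_prob Sm Sp i t" "up_prob Sm Sp i t \<le> 1"
  using assms by (auto simp: up_prob_def strategy_def divide_le_eq_1 add_nonneg_pos
      less_le add_nonneg_nonneg)

lemma nn_integral_unif_threshold:
  assumes "0 \<le> p" "p \<le> 1"
  shows "(\<integral>\<^sup>+s. (if s < p then c else d) \<partial>unif) = ennreal p * c + ennreal (1 - p) * d"
proof -
  have "(\<integral>\<^sup>+s. (if s < p then c else d) \<partial>unif)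
      = (\<integral>\<^sup>+s. c * indicator {..<p} s + d * indicator {p..} s \<partial>unif)"
    by (intro nn_integral_cong) auto
  also have "\<dots> = (\<integral>\<^sup>+s. c * indicator {..<p} s \<partial>unif) + (\<integral>\<^sup>+s. d * indicator {p..} s \<partial>unif)"
    by (intro nn_integral_add) measurable
  also have "\<dots> = c * emeasure unif {..<p} + d * emeasure unif {p..}"
    by (subst (1 2) nn_integral_cmult_indicator) auto
  finally have eq: "(\<integral>\<^sup>+s. (if s < p then c else d) \<partial>unif)
    = c * emeasure unif {..<p} + d * emeasure unif {p..}" .
  have "{0..1} \<inter> {..<p} = {0..<p}" "{0..1} \<inter> {p..} = {p..1}"
    using assms by auto
  then have "emeasure unif {..<p} = ennreal p" "emeasure unif {p..} = ennreal (1 - p)"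
    using assms by (simp_all add: divide_ennreal_def)
  then show ?thesis unfolding eq by (simp add: mult.commute)
qed

text \<open>The noise is the image of one uniform variable times an independent copy of the noise
  under prepending; integrating the first coordinate last gives a two-point average.\<close>

lemma nn_integral_first_step:
  fixes k :: int
  assumes "strategy Sm" "strategy Sp" and [measurable]: "G \<in> borel_measurable paths"
  defines "p \<equiv> up_prob Sm Sp k 1"
  shows "(\<integral>\<^sup>+\<omega>. G (gameplay Sm Sp k \<omega>) \<partial>noise) =
    ennreal p * (\<integral>\<^sup>+\<omega>. G (case_nat k (gameplay (later Sm) (later Sp) (k + 1) \<omega>)) \<partial>noise) +
    ennreal (1 - p) * (\<integral>\<^sup>+\<omega>. G (case_nat k (gameplay (later Sm) (later Sp) (k - 1) \<omega>)) \<partial>noise)"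
    (is "_ = ennreal p * ?u + ennreal (1 - p) * ?d")
proof -
  have noise: "noise = distr (unif \<Otimes>\<^sub>M noise) noise (\<lambda>(s, \<omega>). case_nat s \<omega>)"
    unfolding noise_def by (rule unif_seq.PiM_iter[symmetric])
  have mc [measurable]: "(\<lambda>(s, \<omega>). case_nat s \<omega>) \<in> unif \<Otimes>\<^sub>M noise \<rightarrow>\<^sub>M noise"
    unfolding noise_def by measurable
  have "(\<integral>\<^sup>+\<omega>. G (gameplay Sm Sp k \<omega>) \<partial>noise)
      = (\<integral>\<^sup>+\<omega>. G (gameplay Sm Sp k \<omega>) \<partial>distr (unif \<Otimes>\<^sub>M noise) noise (\<lambda>(s, \<omega>). case_nat s \<omega>))"
    by (simp only: noise[symmetric])
  also have "\<dots> = (\<integral>\<^sup>+x. G (gameplay Sm Sp k (case x of (s, \<omega>) \<Rightarrow> case_nat s \<omega>)) \<partial>(unif \<Otimes>\<^sub>M noise))"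
    by (rule nn_integral_distr) measurable
  also have "\<dots> = (\<integral>\<^sup>+s. \<integral>\<^sup>+\<omega>. G (gameplay Sm Sp k (case_nat s \<omega>)) \<partial>noise \<partial>unif)"
    using noise.nn_integral_fst[of "\<lambda>x. G (gameplay Sm Sp k (case x of (s, \<omega>) \<Rightarrow> case_nat s \<omega>))" unif]
    by simp
  also have "\<dots> = (\<integral>\<^sup>+s. (if s < p then ?u else ?d) \<partial>unif)"
    unfolding gameplay_case_nat p_def by (intro nn_integral_cong) simp
  also have "\<dots> = ennreal p * ?u + ennreal (1 - p) * ?d"
    unfolding p_def using up_prob_bounds[OF assms(1,2)] by (rule nn_integral_unif_threshold)
  finally show ?thesis .
qed

section \<open>Escape, terminal value and running cost as functionals of the path\<close>

lemma measurable_paths_component [measurable]: "(\<lambda>X. X n) \<in> paths \<rightarrow>\<^sub>M count_space UNIV"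
  by (rule measurable_component_singleton) simp

lemma measurable_running_cost [measurable]: "running_cost S \<in> borel_measurable paths"
  unfolding running_cost_def by measurable

lemma measurable_escape [measurable]:
  "Measurable.pred paths escape_left" "Measurable.pred paths escape_right"
proof -
  have [measurable]: "(\<lambda>X. ereal (real_of_int (X n))) \<in> borel_measurable paths" for n
    by (rule measurable_compose[OF measurable_paths_component]) simp
  show "Measurable.pred paths escape_left" "Measurable.pred paths escape_right"
    unfolding escape_left_def escape_right_def by simp_all
qed

lemma measurable_terminal [measurable]: "terminal vL vR vs \<in> borel_measurable paths"
  unfolding terminal_def by measurable

lemma escape_left_iff: "escape_left X \<longleftrightarrow> filterlim X at_bot sequentially"
proof
  assume l: "escape_left X"
  show "filterlim X at_bot sequentially"
    unfolding filterlim_at_bot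
  proof
    fix z :: int
    have "limsup (\<lambda>n. ereal (real_of_int (X n))) < ereal (real_of_int z)"
      using l by (simp add: escape_left_def)
    from Limsup_lessD[OF this] show "\<forall>\<^sub>F n in sequentially. X n \<le> z"
      by eventually_elim simp
  qed
next
  assume "filterlim X at_bot sequentially"
  then have ev: "\<forall>\<^sub>F n in sequentially. X n \<le> z" for z
    by (simp add: filterlim_at_bot)
  have "\<forall>\<^sub>F n in sequentially. ereal (real_of_int (X n)) < ereal r" for r
    using ev[of "\<lfloor>r\<rfloor> - 1"] by eventually_elim (simp, linarith)
  then have "(\<lambda>n. ereal (real_of_int (X n))) \<longlonglongrightarrow> -\<infinity>"
    by (simp add: tendsto_MInfty)
  then show "escape_left X"
    unfolding escape_left_def by (intro lim_imp_Limsup) auto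
qed

lemma escape_right_iff: "escape_right X \<longleftrightarrow> filterlim X at_top sequentially"
proof
  assume l: "escape_right X"
  show "filterlim X at_top sequentially"
    unfolding filterlim_at_top
  proof
    fix z :: int
    have "ereal (real_of_int z) < liminf (\<lambda>n. ereal (real_of_int (X n)))"
      using l by (simp add: escape_right_def)
    from less_LiminfD[OF this] show "\<forall>\<^sub>F n in sequentially. z \<le> X n"
      by eventually_elim simp
  qed
next
  assume "filterlim X at_top sequentially"
  then have ev: "\<forall>\<^sub>F n in sequentially. z \<le> X n" for z
    by (simp add: filterlim_at_top)
  have "\<forall>\<^sub>F n in sequentially. ereal r < ereal (real_of_int (X n))" for r
    using ev[of "\<lceil>r\<rceil> + 1"] by eventually_elim (simp, linarith)
  then have "(\<lambda>n. ereal (real_of_int (X n))) \<longlonglongrightarrow> \<infinity>"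
    by (simp add: tendsto_PInfty)
  then show "escape_right X"
    unfolding escape_right_def by (intro lim_imp_Liminf) auto
qed

lemma not_escape_both: "escape_left X \<Longrightarrow> \<not> escape_right X"
proof
  assume "escape_left X" "escape_right X"
  then have "\<forall>\<^sub>F n in sequentially. X n \<le> 0" "\<forall>\<^sub>F n in sequentially. 1 \<le> X n"
    by (simp_all add: escape_left_iff escape_right_iff filterlim_at_bot filterlim_at_top)
  then have "\<forall>\<^sub>F n::nat in sequentially. False"
    by eventually_elim simp
  then show False by simp
qed

lemma escape_case_nat [simp]:
  "escape_left (case_nat k X) = escape_left X" "escape_right (case_nat k X) = escape_right X"
  unfolding escape_left_iff escape_right_iff
  using filterlim_sequentially_Suc[of "case_nat k X"] by simp_all

lemma terminal_case_nat [simp]: "terminal vL vR vs (case_nat k X) = terminal vL vR vs X"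
  by (simp add: terminal_def)

lemma running_cost_case_nat:
  "running_cost S (case_nat k X) = ennreal (S k 1) + running_cost (later S) X"
  unfolding running_cost_def later_def
  by (subst suminf_offset[of _ 1]) (simp_all add: add.commute)

text \<open>Unit steps cannot jump over 0, so the sign is constant after the last visit to 0.
  Eventually avoiding each window \<open>{- C..C}\<close> with constant sign means divergence to one
  side.\<close>

lemma transient_imp_escape:
  fixes X :: "nat \<Rightarrow> int"
  assumes step: "\<And>n. \<bar>X (Suc n) - X n\<bar> = 1"
    and transient: "\<And>i. \<forall>\<^sub>F n in sequentially. X n \<noteq> i"
  shows "escape_left X \<or> escape_right X"
proof -
  obtain N where N: "\<And>n. N \<le> n \<Longrightarrow> X n \<noteq> 0"
    using transient[of 0] by (auto simp: eventually_sequentially)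
  have avoid: "\<forall>\<^sub>F n in sequentially. \<forall>i\<in>{- C..C}. X n \<noteq> i" for C
    using transient by (intro eventually_ball_finite) auto
  show ?thesis
  proof (cases "0 < X N")
    case True
    have pos: "0 < X n" if "N \<le> n" for n
      using that
    proof (induction n rule: dec_induct)
      case (step n)
      then show ?case using assms(1)[of n] N[of n] N[of "Suc n"] by linarith
    qed (rule True)
    have "\<forall>\<^sub>F n in sequentially. C \<le> X n" for C
      using avoid[of C] eventually_ge_at_top[of N]
    proof eventually_elim
      case (elim n)
      then show ?case using pos[of n] by force
    qed
    then show ?thesis by (simp add: escape_right_iff filterlim_at_top)
  next
    case False
    have neg: "X n < 0" if "N \<le> n" for n
      using that
    proof (induction n rule: dec_induct)
      case base
      then show ?case using False N[of N] by simp
    next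
      case (step n)
      then show ?case using assms(1)[of n] N[of n] N[of "Suc n"] by linarith
    qed
    have "\<forall>\<^sub>F n in sequentially. X n \<le> C" for C
      using avoid[of "- C"] eventually_ge_at_top[of N]
    proof eventually_elim
      case (elim n)
      then show ?case using neg[of n] by force
    qed
    then show ?thesis by (simp add: escape_left_iff filterlim_at_bot)
  qed
qed

text \<open>A finite total cost forces the stakes along the path to 0, whereas infinitely many
  visits to \<open>i\<close> would cost \<open>s i > 0\<close> each time.\<close>

lemma finite_cost_imp_escape:
  assumes "\<And>i t. S i (Suc t) = s i" "\<And>i. 0 < s i"
    and "running_cost S (gameplay Sm Sp k \<omega>) \<noteq> \<infinity>"
  shows "escape_left (gameplay Sm Sp k \<omega>) \<or> escape_right (gameplay Sm Sp k \<omega>)"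
proof (rule transient_imp_escape)
  let ?X = "gameplay Sm Sp k \<omega>"
  show "\<bar>?X (Suc n) - ?X n\<bar> = 1" for n by simp
  have "summable (\<lambda>t. s (?X t))"
    using assms by (intro summable_suminf_not_top) (auto simp: running_cost_def less_imp_le)
  then have lim: "(\<lambda>t. s (?X t)) \<longlonglongrightarrow> 0" by (rule summable_LIMSEQ_zero)
  show "\<forall>\<^sub>F n in sequentially. ?X n \<noteq> i" for i
    using order_tendstoD(2)[OF lim assms(2)[of i]] by eventually_elim auto
qed

section \<open>Expected payoffs\<close>

abbreviation cost_upto :: "(int \<Rightarrow> nat \<Rightarrow> real) \<Rightarrow> nat \<Rightarrow> (nat \<Rightarrow> int) \<Rightarrow> ennreal" where
  "cost_upto S t X \<equiv> (\<Sum>u<t. ennreal (S (X u) (Suc u)))"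

lemma cost_upto_case_nat:
  "cost_upto S (Suc t) (case_nat k X) = ennreal (S k 1) + cost_upto (later S) t X"
  by (subst sum.lessThan_Suc_shift) (simp add: later_def)

lemma nn_integral_const_add_noise:
  "f \<in> borel_measurable noise \<Longrightarrow> (\<integral>\<^sup>+\<omega>. c + f \<omega> \<partial>noise) = c + (\<integral>\<^sup>+\<omega>. f \<omega> \<partial>noise)"
  by (subst nn_integral_add) (simp_all add: noise.emeasure_space_1)

lemma ennreal_convex_add:
  assumes "0 \<le> p" "p \<le> 1"
  shows "ennreal p * (c + x) + ennreal (1 - p) * (c + y) = c + (ennreal p * x + ennreal (1 - p) * y)"
proof -
  have "ennreal p + ennreal (1 - p) = 1"
    using assms by (simp flip: ennreal_plus)
  moreover have "ennreal p * (c + x) + ennreal (1 - p) * (c + y)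
      = (ennreal p + ennreal (1 - p)) * c + (ennreal p * x + ennreal (1 - p) * y)"
    by (simp only: distrib_left distrib_right ac_simps)
  ultimately show ?thesis by simp
qed

lemma expected_cost_upto_first_step:
  assumes "strategy Sm" "strategy Sp"
  shows "(\<integral>\<^sup>+\<omega>. cost_upto S (Suc t) (gameplay Sm Sp k \<omega>) \<partial>noise) = ennreal (S k 1) +
    (ennreal (up_prob Sm Sp k 1) *
       (\<integral>\<^sup>+\<omega>. cost_upto (later S) t (gameplay (later Sm) (later Sp) (k + 1) \<omega>) \<partial>noise) +
     ennreal (1 - up_prob Sm Sp k 1) *
       (\<integral>\<^sup>+\<omega>. cost_upto (later S) t (gameplay (later Sm) (later Sp) (k - 1) \<omega>) \<partial>noise))"
  using nn_integral_first_step[OF assms, of "cost_upto S (Suc t)" k]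
  unfolding cost_upto_case_nat
  by (simp add: nn_integral_const_add_noise ennreal_convex_add up_prob_bounds[OF assms]
      del: sum.lessThan_Suc)

lemma expected_running_cost_first_step:
  assumes "strategy Sm" "strategy Sp"
  shows "(\<integral>\<^sup>+\<omega>. running_cost S (gameplay Sm Sp k \<omega>) \<partial>noise) = ennreal (S k 1) +
    (ennreal (up_prob Sm Sp k 1) *
       (\<integral>\<^sup>+\<omega>. running_cost (later S) (gameplay (later Sm) (later Sp) (k + 1) \<omega>) \<partial>noise) +
     ennreal (1 - up_prob Sm Sp k 1) *
       (\<integral>\<^sup>+\<omega>. running_cost (later S) (gameplay (later Sm) (later Sp) (k - 1) \<omega>) \<partial>noise))"
  using nn_integral_first_step[OF assms, of "running_cost S" k]
  unfolding running_cost_case_nat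
  by (simp add: nn_integral_const_add_noise ennreal_convex_add up_prob_bounds[OF assms])

text \<open>The defect \<open>D\<close> is the one-step loss of the supermartingale formed by the value minus the
  accumulated cost; all terms are kept nonnegative so that no integrability is needed.\<close>

lemma value_cost_balance:
  assumes "strategy Sm" "strategy Sp" "strategy S" "strategy D"
    and w: "\<And>i. 0 \<le> w i"
    and step: "\<And>i t. up_prob Sm Sp i (Suc t) * w (i + 1) + (1 - up_prob Sm Sp i (Suc t)) * w (i - 1)
      + D i (Suc t) = w i + S i (Suc t)"
  shows "(\<integral>\<^sup>+\<omega>. ennreal (w (gameplay Sm Sp k \<omega> t)) \<partial>noise)
      + (\<integral>\<^sup>+\<omega>. cost_upto D t (gameplay Sm Sp k \<omega>) \<partial>noise)
    = ennreal (w k) + (\<integral>\<^sup>+\<omega>. cost_upto S t (gameplay Sm Sp k \<omega>) \<partial>noise)"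
  using assms
proof (induction t arbitrary: Sm Sp S D k)
  case 0
  then show ?case by (simp add: noise.emeasure_space_1)
next
  case (Suc t)
  note st = Suc.prems(1-4)
  define p where "p = up_prob Sm Sp k 1"
  define q where "q = 1 - p"
  have p: "0 \<le> p" "0 \<le> q"
    unfolding p_def q_def using up_prob_bounds[OF st(1,2), of k 1] by auto
  let ?E = "\<lambda>i. \<integral>\<^sup>+\<omega>. ennreal (w (gameplay (later Sm) (later Sp) i \<omega> t)) \<partial>noise"
  let ?D = "\<lambda>i. \<integral>\<^sup>+\<omega>. cost_upto (later D) t (gameplay (later Sm) (later Sp) i \<omega>) \<partial>noise"
  let ?S = "\<lambda>i. \<integral>\<^sup>+\<omega>. cost_upto (later S) t (gameplay (later Sm) (later Sp) i \<omega>) \<partial>noise"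
  have up_later: "up_prob (later Sm) (later Sp) i n = up_prob Sm Sp i (Suc n)" for i n
    by (simp add: up_prob_def later_def)
  have IH: "?E i + ?D i = ennreal (w i) + ?S i" for i
  proof (rule Suc.IH)
    show "up_prob (later Sm) (later Sp) i (Suc n) * w (i + 1)
      + (1 - up_prob (later Sm) (later Sp) i (Suc n)) * w (i - 1) + later D i (Suc n)
      = w i + later S i (Suc n)" for i n
      using Suc.prems(6)[of i "Suc n"] by (simp add: up_later later_def)
  qed (use st w in \<open>simp_all add: strategy_later\<close>)
  have E: "(\<integral>\<^sup>+\<omega>. ennreal (w (gameplay Sm Sp k \<omega> (Suc t))) \<partial>noise) = ennreal p * ?E (k + 1) + ennreal q * ?E (k - 1)"
    unfolding p_def q_def
    using nn_integral_first_step[OF st(1,2), of "\<lambda>X. ennreal (w (X (Suc t)))" k] by simp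
  have "(\<integral>\<^sup>+\<omega>. ennreal (w (gameplay Sm Sp k \<omega> (Suc t))) \<partial>noise)
      + (\<integral>\<^sup>+\<omega>. cost_upto D (Suc t) (gameplay Sm Sp k \<omega>) \<partial>noise)
    = ennreal (D k 1) + (ennreal p * (?E (k + 1) + ?D (k + 1)) + ennreal q * (?E (k - 1) + ?D (k - 1)))"
    unfolding E expected_cost_upto_first_step[OF st(1,2)] p_def[symmetric] q_def[symmetric]
    by (simp add: distrib_left ac_simps)
  also have "\<dots> = (ennreal p * ennreal (w (k + 1)) + ennreal q * ennreal (w (k - 1)) + ennreal (D k 1))
      + (ennreal p * ?S (k + 1) + ennreal q * ?S (k - 1))"
    unfolding IH by (simp add: distrib_left ac_simps)
  also have "ennreal p * ennreal (w (k + 1)) + ennreal q * ennreal (w (k - 1)) + ennreal (D k 1)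
      = ennreal (p * w (k + 1) + q * w (k - 1) + D k 1)"
    using p w st(4) by (simp add: ennreal_mult strategy_def)
  also have "\<dots> = ennreal (w k) + ennreal (S k 1)"
    unfolding p_def q_def using Suc.prems(6)[of k 0] st(3) w by (simp add: strategy_def)
  finally show ?case
    unfolding expected_cost_upto_first_step[OF st(1,2)] p_def[symmetric] q_def[symmetric]
    by (simp add: ac_simps)
qed

section \<open>Comparing expected payoffs with a value function\<close>

lemma integrable_terminal [simp, intro]: "integrable noise (\<lambda>\<omega>. terminal vL vR vs (gameplay Sm Sp k \<omega>))"
proof (rule noise.integrable_const_bound)
  have "\<bar>terminal vL vR vs X\<bar> \<le> \<bar>vL\<bar> + \<bar>vR\<bar> + \<bar>vs\<bar>" for X
    by (auto simp: terminal_def)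
  then show "AE \<omega> in noise. norm (terminal vL vR vs (gameplay Sm Sp k \<omega>)) \<le> \<bar>vL\<bar> + \<bar>vR\<bar> + \<bar>vs\<bar>"
    by simp
qed measurable

lemma integral_terminal_ge:
  assumes "lo \<le> vL" "lo \<le> vR" "lo \<le> vs"
  shows "lo \<le> (\<integral>\<omega>. terminal vL vR vs (gameplay Sm Sp k \<omega>) \<partial>noise)"
  using assms by (intro noise.integral_ge_const integrable_terminal) (simp add: terminal_def)

lemma integral_terminal_le:
  assumes "vL \<le> hi" "vR \<le> hi" "vs \<le> hi"
  shows "(\<integral>\<omega>. terminal vL vR vs (gameplay Sm Sp k \<omega>) \<partial>noise) \<le> hi"
  using assms by (intro noise.integral_le_const integrable_terminal) (simp add: terminal_def)

lemma tendsto_value_of_escape: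
  fixes v :: "int \<Rightarrow> real"
  assumes "(v \<longlongrightarrow> vL) at_bot" "(v \<longlongrightarrow> vR) at_top" "escape_left X \<or> escape_right X"
  shows "(\<lambda>t. v (X t)) \<longlonglongrightarrow> terminal vL vR vs X"
  using assms not_escape_both[of X]
  by (auto simp: terminal_def escape_left_iff escape_right_iff intro: filterlim_compose)

lemma nn_integral_terminal:
  assumes "lo \<le> vL" "lo \<le> vR" "lo \<le> vs"
  shows "(\<integral>\<^sup>+\<omega>. ennreal (terminal vL vR vs (gameplay Sm Sp k \<omega>) - lo) \<partial>noise)
    = ennreal ((\<integral>\<omega>. terminal vL vR vs (gameplay Sm Sp k \<omega>) \<partial>noise) - lo)"
proof -
  have "lo \<le> terminal vL vR vs X" for X
    using assms by (auto simp: terminal_def)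
  then show ?thesis
    by (subst nn_integral_eq_integral) (auto simp: noise.prob_space intro!: Bochner_Integration.integrable_diff)
qed

lemma cost_upto_le: "cost_upto S t X \<le> running_cost S X"
  unfolding running_cost_def by (rule sum_le_suminf) auto

text \<open>The balance with a nonnegative defect bounds the expectation of \<open>w\<close> at
  every time, and Fatou's lemma passes to the terminal value. Shifting by \<open>vs\<close> makes
  the terminal value vanish on paths without escape, so no limit of \<open>v\<close> is required
  there.\<close>

lemma expected_payoff_le:
  assumes st: "strategy Sm" "strategy Sp" "strategy S"
    and lower: "\<And>i. vs \<le> v i"
    and lim: "(v \<longlongrightarrow> vL) at_bot" "(v \<longlongrightarrow> vR) at_top"
    and step: "\<And>i t. up_prob Sm Sp i (Suc t) * v (i + 1) + (1 - up_prob Sm Sp i (Suc t)) * v (i - 1)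
      \<le> v i + S i (Suc t)"
  shows "expected_payoff vL vR vs S Sm Sp k \<le> ereal (v k)"
proof -
  define w where "w i = v i - vs" for i
  let ?p = "up_prob Sm Sp"
  \<comment> \<open>\<open>step\<close> speaks of times \<open>Suc t\<close>; the value 0 at time 0
    makes \<open>D\<close> nonnegative everywhere, as \<open>strategy\<close> demands.\<close>
  define D where "D i t = (if t = 0 then 0
    else w i + S i t - (?p i t * w (i + 1) + (1 - ?p i t) * w (i - 1)))" for i t
  have w: "0 \<le> w i" for i using lower by (simp add: w_def)
  have pw: "?p i t * w (i + 1) + (1 - ?p i t) * w (i - 1) = ?p i t * v (i + 1) + (1 - ?p i t) * v (i - 1) - vs" for i t
    by (simp add: w_def algebra_simps)
  have "0 \<le> D i t" for i t
  proof (cases t)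
    case (Suc u)
    show ?thesis
      using step[of i u] unfolding Suc D_def pw by (simp add: w_def)
  qed (simp add: D_def)
  then have D: "strategy D" by (simp add: strategy_def)
  let ?X = "gameplay Sm Sp k"
  let ?C = "\<integral>\<^sup>+\<omega>. running_cost S (?X \<omega>) \<partial>noise"
  have vLR: "vs \<le> vL" "vs \<le> vR"
    using lim lower by (auto intro!: tendsto_lowerbound[OF lim(1)] tendsto_lowerbound[OF lim(2)] always_eventually)
  have le: "(\<integral>\<^sup>+\<omega>. ennreal (w (?X \<omega> t)) \<partial>noise) \<le> ennreal (w k) + ?C" for t
  proof -
    have "(\<integral>\<^sup>+\<omega>. ennreal (w (?X \<omega> t)) \<partial>noise)
      \<le> ennreal (w k) + (\<integral>\<^sup>+\<omega>. cost_upto S t (?X \<omega>) \<partial>noise)"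
      by (subst value_cost_balance[OF st D w, symmetric]) (simp_all add: D_def)
    also have "\<dots> \<le> ennreal (w k) + ?C"
      by (intro add_left_mono nn_integral_mono cost_upto_le)
    finally show ?thesis .
  qed
  have "ennreal (terminal vL vR vs (?X \<omega>) - vs) \<le> liminf (\<lambda>t. ennreal (w (?X \<omega> t)))" for \<omega>
  proof (cases "escape_left (?X \<omega>) \<or> escape_right (?X \<omega>)")
    case True
    have "(\<lambda>t. w (?X \<omega> t)) \<longlonglongrightarrow> terminal vL vR vs (?X \<omega>) - vs"
      unfolding w_def by (intro tendsto_intros tendsto_value_of_escape[OF lim True])
    then have "(\<lambda>t. ennreal (w (?X \<omega> t))) \<longlonglongrightarrow> ennreal (terminal vL vR vs (?X \<omega>) - vs)"
      by (rule tendsto_ennrealI)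
    then show ?thesis by (simp add: lim_imp_Liminf)
  qed (simp add: terminal_def)
  then have "(\<integral>\<^sup>+\<omega>. ennreal (terminal vL vR vs (?X \<omega>) - vs) \<partial>noise)
      \<le> (\<integral>\<^sup>+\<omega>. liminf (\<lambda>t. ennreal (w (?X \<omega> t))) \<partial>noise)"
    by (intro nn_integral_mono)
  also have "\<dots> \<le> liminf (\<lambda>t. \<integral>\<^sup>+\<omega>. ennreal (w (?X \<omega> t)) \<partial>noise)"
    by (rule nn_integral_liminf) measurable
  also have "\<dots> \<le> ennreal (w k) + ?C"
    using le by (intro Liminf_le) (auto intro: always_eventually)
  finally have *: "ennreal ((\<integral>\<omega>. terminal vL vR vs (?X \<omega>) \<partial>noise) - vs) \<le> ennreal (w k) + ?C"
    unfolding nn_integral_terminal[OF vLR order_refl] .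
  show ?thesis
  proof (cases ?C)
    case (real c)
    then have "ennreal ((\<integral>\<omega>. terminal vL vR vs (?X \<omega>) \<partial>noise) - vs) \<le> ennreal (w k + c)"
      using * w by (simp add: ennreal_plus)
    then have "(\<integral>\<omega>. terminal vL vR vs (?X \<omega>) \<partial>noise) - vs \<le> w k + c"
      using w[of k] real by (subst (asm) ennreal_le_iff) auto
    then show ?thesis
      unfolding expected_payoff_def using real by (simp add: w_def)
  next
    case top
    then show ?thesis unfolding expected_payoff_def by simp
  qed
qed

text \<open>With zero defect, boundedness of \<open>v\<close> bounds the expected cost. Finite cost
  at positive stakes forces escape almost surely, and then dominated convergence turns the balance
  into an equality in the limit.\<close>

lemma expected_payoff_eq:
  assumes st: "strategy Sm" "strategy Sp" "strategy S"
    and inv: "\<And>i t. S i (Suc t) = s i" "\<And>i. 0 < s i"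
    and bounds: "\<And>i. lo \<le> v i" "\<And>i. v i \<le> hi"
    and lim: "(v \<longlongrightarrow> vL) at_bot" "(v \<longlongrightarrow> vR) at_top"
    and step: "\<And>i t. up_prob Sm Sp i (Suc t) * v (i + 1) + (1 - up_prob Sm Sp i (Suc t)) * v (i - 1)
      = v i + S i (Suc t)"
  shows "expected_payoff vL vR vs S Sm Sp k = ereal (v k)"
    and "AE \<omega> in noise. escape_left (gameplay Sm Sp k \<omega>) \<or> escape_right (gameplay Sm Sp k \<omega>)"
    and "(\<integral>\<^sup>+\<omega>. running_cost S (gameplay Sm Sp k \<omega>) \<partial>noise) \<noteq> \<infinity>"
proof -
  define w where "w i = v i - lo" for i
  have w: "0 \<le> w i" "w i \<le> hi - lo" for i using bounds by (auto simp: w_def)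
  let ?X = "gameplay Sm Sp k"
  let ?C = "\<integral>\<^sup>+\<omega>. running_cost S (?X \<omega>) \<partial>noise"
  let ?c = "\<lambda>t. \<integral>\<^sup>+\<omega>. cost_upto S t (?X \<omega>) \<partial>noise"
  have eq: "(\<integral>\<^sup>+\<omega>. ennreal (w (?X \<omega> t)) \<partial>noise) = ennreal (w k) + ?c t" for t
    using value_cost_balance[OF st, of "\<lambda>_ _. 0" w k t] step w(1)
    by (simp add: strategy_def w_def algebra_simps)
  have C: "?C = (SUP t. ?c t)"
  proof -
    have "?C = (\<integral>\<^sup>+\<omega>. (SUP t. cost_upto S t (?X \<omega>)) \<partial>noise)"
      unfolding running_cost_def by (simp add: suminf_eq_SUP)
    also have "\<dots> = (SUP t. ?c t)"
      by (rule nn_integral_monotone_convergence_SUP)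
        (auto intro!: incseq_SucI le_funI simp: add_increasing2)
    finally show ?thesis .
  qed
  have "?c t \<le> ennreal (hi - lo)" for t
  proof -
    have "?c t \<le> (\<integral>\<^sup>+\<omega>. ennreal (w (?X \<omega> t)) \<partial>noise)" unfolding eq by simp
    also have "\<dots> \<le> (\<integral>\<^sup>+\<omega>. ennreal (hi - lo) \<partial>noise)"
      using w by (intro nn_integral_mono ennreal_leI)
    finally show ?thesis by (simp add: noise.emeasure_space_1)
  qed
  then have "?C \<le> ennreal (hi - lo)" unfolding C by (rule SUP_least)
  then show fin: "?C \<noteq> \<infinity>" by (auto simp: top_unique)
  have "AE \<omega> in noise. running_cost S (?X \<omega>) \<noteq> \<infinity>"
    by (rule nn_integral_PInf_AE) (use fin in auto)
  then show esc: "AE \<omega> in noise. escape_left (?X \<omega>) \<or> escape_right (?X \<omega>)"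
    by eventually_elim (rule finite_cost_imp_escape[where S = S and s = s], simp_all add: inv)
  have loLR: "lo \<le> vL" "lo \<le> vR"
    using lim bounds by (auto intro!: tendsto_lowerbound[OF lim(1)] tendsto_lowerbound[OF lim(2)] always_eventually)
  have "(\<lambda>t. \<integral>\<^sup>+\<omega>. ennreal (w (?X \<omega> t)) \<partial>noise)
      \<longlonglongrightarrow> (\<integral>\<^sup>+\<omega>. ennreal (terminal vL vR lo (?X \<omega>) - lo) \<partial>noise)"
  proof (rule nn_integral_dominated_convergence[where w = "\<lambda>_. ennreal (hi - lo)"])
    show "AE \<omega> in noise. (\<lambda>t. ennreal (w (?X \<omega> t))) \<longlonglongrightarrow> ennreal (terminal vL vR lo (?X \<omega>) - lo)"
      using esc
    proof eventually_elim
      case (elim \<omega>)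
      show ?case
        unfolding w_def by (intro tendsto_ennrealI tendsto_intros tendsto_value_of_escape[OF lim elim])
    qed
  qed (use w in \<open>auto simp: noise.emeasure_space_1 intro!: ennreal_leI\<close>)
  moreover have "(\<lambda>t. \<integral>\<^sup>+\<omega>. ennreal (w (?X \<omega> t)) \<partial>noise) \<longlonglongrightarrow> ennreal (w k) + ?C"
    unfolding eq C
    by (intro tendsto_add tendsto_const LIMSEQ_SUP incseq_SucI nn_integral_mono)
      (simp add: add_increasing2)
  ultimately have *: "ennreal ((\<integral>\<omega>. terminal vL vR lo (?X \<omega>) \<partial>noise) - lo) = ennreal (w k) + ?C"
    unfolding nn_integral_terminal[OF loLR order_refl] by (rule LIMSEQ_unique)
  obtain c where c: "0 \<le> c" "?C = ennreal c" using fin by (cases ?C) auto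
  have "lo \<le> (\<integral>\<omega>. terminal vL vR lo (?X \<omega>) \<partial>noise)"
    using loLR by (rule integral_terminal_ge) simp
  then have "(\<integral>\<omega>. terminal vL vR lo (?X \<omega>) \<partial>noise) - lo = w k + c"
    using * w(1)[of k] c by (simp flip: ennreal_plus)
  \<comment> \<open>The third terminal value is taken on a null set only, so \<open>lo\<close> may
    stand in for \<open>vs\<close>.\<close>
  moreover have "(\<integral>\<omega>. terminal vL vR vs (?X \<omega>) \<partial>noise) = (\<integral>\<omega>. terminal vL vR lo (?X \<omega>) \<partial>noise)"
    by (rule integral_cong_AE) (use esc in \<open>auto simp: terminal_def\<close>)
  ultimately show "expected_payoff vL vR vs S Sm Sp k = ereal (v k)"
    unfolding expected_payoff_def using c by (simp add: w_def)
qed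

section \<open>Deviations\<close>

text \<open>Turns are numbered from 1, so agreement at the times \<open>Suc t\<close> determines
  play and costs.\<close>

lemma expected_payoff_cong:
  assumes "\<And>i t. S i (Suc t) = S' i (Suc t)" "\<And>i t. Sm i (Suc t) = Sm' i (Suc t)"
    "\<And>i t. Sp i (Suc t) = Sp' i (Suc t)"
  shows "expected_payoff vL vR vs S Sm Sp k = expected_payoff vL vR vs S' Sm' Sp' k"
proof -
  have "gameplay Sm Sp k \<omega> n = gameplay Sm' Sp' k \<omega> n" for \<omega> n
    by (induction n) (simp_all add: up_prob_def assms)
  then have "gameplay Sm Sp k = gameplay Sm' Sp' k" by blast
  then show ?thesis
    by (simp add: expected_payoff_def running_cost_def assms)
qed

lemma expected_payoff_realE:
  assumes "expected_payoff vL vR vs S Sm Sp k = ereal u"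
  obtains c where "0 \<le> c" "(\<integral>\<^sup>+\<omega>. running_cost S (gameplay Sm Sp k \<omega>) \<partial>noise) = ennreal c"
    "u = (\<integral>\<omega>. terminal vL vR vs (gameplay Sm Sp k \<omega>) \<partial>noise) - c"
proof (cases "\<integral>\<^sup>+\<omega>. running_cost S (gameplay Sm Sp k \<omega>) \<partial>noise")
  case (real c)
  then show ?thesis
    using assms by (intro that[of c]) (simp_all add: expected_payoff_def)
next
  case top
  then show ?thesis using assms by (simp add: expected_payoff_def)
qed

lemma integral_terminal_first_step:
  fixes vL vR vs :: real
  assumes st: "strategy Sm" "strategy Sp"
  defines "E \<equiv> \<lambda>Sm Sp k. \<integral>\<omega>. terminal vL vR vs (gameplay Sm Sp k \<omega>) \<partial>noise"
  shows "E Sm Sp k = up_prob Sm Sp k 1 * E (later Sm) (later Sp) (k + 1)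
    + (1 - up_prob Sm Sp k 1) * E (later Sm) (later Sp) (k - 1)"
proof -
  define lo where "lo = min vs (min vL vR)"
  have lo: "lo \<le> vL" "lo \<le> vR" "lo \<le> vs" by (auto simp: lo_def)
  let ?p = "up_prob Sm Sp k 1"
  have p: "0 \<le> ?p" "?p \<le> 1" using up_prob_bounds[OF st] by auto
  have ge: "0 \<le> E Sm Sp k - lo" for Sm Sp k
    unfolding E_def using integral_terminal_ge[OF lo] by simp
  have "ennreal (E Sm Sp k - lo) = ennreal ?p * ennreal (E (later Sm) (later Sp) (k + 1) - lo)
    + ennreal (1 - ?p) * ennreal (E (later Sm) (later Sp) (k - 1) - lo)"
    using nn_integral_first_step[OF st, of "\<lambda>X. ennreal (terminal vL vR vs X - lo)" k]
    unfolding terminal_case_nat nn_integral_terminal[OF lo] E_def by simp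
  also have "\<dots> = ennreal (?p * (E (later Sm) (later Sp) (k + 1) - lo)
    + (1 - ?p) * (E (later Sm) (later Sp) (k - 1) - lo))"
    using p ge by (simp add: ennreal_mult)
  finally have "E Sm Sp k - lo = ?p * (E (later Sm) (later Sp) (k + 1) - lo)
    + (1 - ?p) * (E (later Sm) (later Sp) (k - 1) - lo)"
    using p ge by (subst (asm) ennreal_inj) auto
  then show ?thesis by (simp add: algebra_simps)
qed

text \<open>Real continuation payoffs mean finite continuation costs, so the recursions for the
  terminal value and for the cost can be subtracted.\<close>

lemma expected_payoff_first_step:
  assumes st: "strategy Sm" "strategy Sp" "strategy S"
    and up: "expected_payoff vL vR vs (later S) (later Sm) (later Sp) (k + 1) = ereal u"
    and down: "expected_payoff vL vR vs (later S) (later Sm) (later Sp) (k - 1) = ereal d"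
  shows "expected_payoff vL vR vs S Sm Sp k
    = ereal (up_prob Sm Sp k 1 * u + (1 - up_prob Sm Sp k 1) * d - S k 1)"
proof -
  obtain c where c: "0 \<le> c" "(\<integral>\<^sup>+\<omega>. running_cost (later S) (gameplay (later Sm) (later Sp) (k + 1) \<omega>) \<partial>noise) = ennreal c"
    "u = (\<integral>\<omega>. terminal vL vR vs (gameplay (later Sm) (later Sp) (k + 1) \<omega>) \<partial>noise) - c"
    using up by (rule expected_payoff_realE)
  obtain e where e: "0 \<le> e" "(\<integral>\<^sup>+\<omega>. running_cost (later S) (gameplay (later Sm) (later Sp) (k - 1) \<omega>) \<partial>noise) = ennreal e"
    "d = (\<integral>\<omega>. terminal vL vR vs (gameplay (later Sm) (later Sp) (k - 1) \<omega>) \<partial>noise) - e"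
    using down by (rule expected_payoff_realE)
  let ?p = "up_prob Sm Sp k 1"
  have "0 \<le> ?p" "?p \<le> 1" "0 \<le> S k 1"
    using up_prob_bounds[OF st(1,2)] st(3) by (auto simp: strategy_def)
  then have "(\<integral>\<^sup>+\<omega>. running_cost S (gameplay Sm Sp k \<omega>) \<partial>noise) = ennreal (S k 1 + (?p * c + (1 - ?p) * e))"
    "0 \<le> S k 1 + (?p * c + (1 - ?p) * e)"
    unfolding expected_running_cost_first_step[OF st(1,2)] c(2) e(2) using c(1) e(1)
    by (simp_all add: ennreal_mult)
  then show ?thesis
    unfolding expected_payoff_def c(3) e(3)
    using integral_terminal_first_step[OF st(1,2), of vL vR vs k]
    by (simp add: algebra_simps)
qed

lemma expected_payoff_le_max:
  assumes "vL \<le> hi" "vR \<le> hi" "vs \<le> hi"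
  shows "expected_payoff vL vR vs S Sm Sp k \<le> ereal hi"
proof -
  have "expected_payoff vL vR vs S Sm Sp k \<le> ereal (\<integral>\<omega>. terminal vL vR vs (gameplay Sm Sp k \<omega>) \<partial>noise)"
    unfolding expected_payoff_def
    by (cases "\<integral>\<^sup>+\<omega>. running_cost S (gameplay Sm Sp k \<omega>) \<partial>noise") auto
  also have "\<dots> \<le> ereal hi"
    using integral_terminal_le[OF assms] by simp
  finally show ?thesis .
qed

section \<open>Playing for free and buying every turn\<close>

lemma expected_payoff_zero_stakes:
  "expected_payoff vL vR vs (\<lambda>_ _. 0) Sm Sp k = ereal (\<integral>\<omega>. terminal vL vR vs (gameplay Sm Sp k \<omega>) \<partial>noise)"
  by (simp add: expected_payoff_def running_cost_def zero_ennreal.rep_eq)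

text \<open>The endpoint 1 is excluded so that up-probability 1 really means a step up: the
  comparison in \<open>gameplay\<close> is strict.\<close>

lemma AE_noise_unit: "AE \<omega> in noise. \<forall>n. 0 \<le> \<omega> n \<and> \<omega> n < 1"
proof (subst AE_all_countable, rule allI)
  fix n
  have "AE s in unif. 0 \<le> s \<and> s < 1"
  proof (rule AE_uniform_measureI)
    show "AE s in lborel. s \<in> {0..1} \<longrightarrow> 0 \<le> s \<and> s < (1::real)"
      using AE_lborel_singleton[of 1] by eventually_elim auto
  qed simp
  then show "AE \<omega> in noise. 0 \<le> \<omega> n \<and> \<omega> n < 1"
    unfolding noise_def by (intro AE_PiM_component prob_space_unif) auto
qed

text \<open>Against an opponent who never stakes, the stakes \<open>e / 2, e / 4, \<dots>\<close> buy every turn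
  at total price \<open>e\<close>.\<close>

lemma nn_integral_geometric_cost:
  assumes "0 < e"
  shows "(\<integral>\<^sup>+\<omega>. running_cost (\<lambda>_ t. e * (1 / 2) ^ t) (X \<omega>) \<partial>noise) = ennreal e"
proof -
  have "(\<lambda>t. e * (1 / 2) ^ Suc t) sums (e * 1)"
    using sums_mult[OF power_half_series, of e] by simp
  then have "(\<Sum>t. ennreal (e * (1 / 2) ^ Suc t)) = ennreal e"
    using assms by (intro suminf_ennreal_eq) auto
  then show ?thesis
    by (simp add: running_cost_def noise.emeasure_space_1)
qed

text \<open>The up-probability is 1 at every turn, so almost surely the path is
  \<open>k + int n\<close>.\<close>

lemma expected_payoff_buy_right:
  assumes "0 < e"
  shows "expected_payoff vL vR vs (\<lambda>_ t. e * (1 / 2) ^ t) (\<lambda>_ _. 0) (\<lambda>_ t. e * (1 / 2) ^ t) k = ereal (vR - e)"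
proof -
  let ?X = "gameplay (\<lambda>_ _. 0) (\<lambda>_ t. e * (1 / 2) ^ t) k"
  have "AE \<omega> in noise. terminal vL vR vs (?X \<omega>) = vR"
    using AE_noise_unit
  proof eventually_elim
    case (elim \<omega>)
    have "?X \<omega> n = k + int n" for n
      using elim assms by (induction n) (auto simp: up_prob_def)
    then have "?X \<omega> = (\<lambda>n. k + int n)" by blast
    moreover have "filterlim (\<lambda>n. k + int n) at_top sequentially"
      unfolding filterlim_at_top
    proof
      fix z
      show "\<forall>\<^sub>F n in sequentially. z \<le> k + int n"
        using eventually_ge_at_top[of "nat (z - k)"] by eventually_elim linarith
    qed
    ultimately have "escape_right (?X \<omega>)" by (simp add: escape_right_iff)
    then show ?case using not_escape_both[of "?X \<omega>"] by (auto simp: terminal_def)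
  qed
  then have "(\<integral>\<omega>. terminal vL vR vs (?X \<omega>) \<partial>noise) = (\<integral>\<omega>. vR \<partial>noise)"
    by (intro integral_cong_AE) auto
  then show ?thesis
    unfolding expected_payoff_def nn_integral_geometric_cost[OF assms]
    using assms by (simp add: noise.prob_space)
qed

lemma expected_payoff_buy_left:
  assumes "0 < e"
  shows "expected_payoff vL vR vs (\<lambda>_ t. e * (1 / 2) ^ t) (\<lambda>_ t. e * (1 / 2) ^ t) (\<lambda>_ _. 0) k = ereal (vL - e)"
proof -
  let ?X = "gameplay (\<lambda>_ t. e * (1 / 2) ^ t) (\<lambda>_ _. 0) k"
  have "AE \<omega> in noise. terminal vL vR vs (?X \<omega>) = vL"
    using AE_noise_unit
  proof eventually_elim
    case (elim \<omega>)
    have "?X \<omega> n = k - int n" for n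
      using elim assms by (induction n) (auto simp: up_prob_def not_less)
    then have "?X \<omega> = (\<lambda>n. k - int n)" by blast
    moreover have "filterlim (\<lambda>n. k - int n) at_bot sequentially"
      unfolding filterlim_at_bot
    proof
      fix z
      show "\<forall>\<^sub>F n in sequentially. k - int n \<le> z"
        using eventually_ge_at_top[of "nat (k - z)"] by eventually_elim linarith
    qed
    ultimately have "escape_left (?X \<omega>)" by (simp add: escape_left_iff)
    then show ?case by (auto simp: terminal_def)
  qed
  then have "(\<integral>\<omega>. terminal vL vR vs (?X \<omega>) \<partial>noise) = (\<integral>\<omega>. vL \<partial>noise)"
    by (intro integral_cong_AE) auto
  then show ?thesis
    unfolding expected_payoff_def nn_integral_geometric_cost[OF assms]
    using assms by (simp add: noise.prob_space)
qed

section \<open>Optimal stakes in a single turn, for either player\<close>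

definition share :: "real \<Rightarrow> real \<Rightarrow> real" where
  "share s c = (if c + s = 0 then 1 / 2 else s / (c + s))"

lemma up_prob_share: "up_prob Sm Sp i t = share (Sp i t) (Sm i t)"
  by (simp add: up_prob_def share_def)

lemma share_swap: "1 - share s c = share c s"
proof (cases "c + s = 0")
  case False
  then have "s + c \<noteq> 0" by linarith
  with False show ?thesis by (simp add: share_def add.commute[of s] diff_divide_eq_iff)
qed (simp add: share_def add.commute)

text \<open>Against a zero stake any positive stake wins, so halving it is cheaper and
  \<open>s = 0\<close>. The fair coin must then be as good as winning at price \<open>e / 2\<close>,
  which gives \<open>vp \<le> vm + e\<close>.\<close>

lemma optimal_stake_zero:
  fixes s vp vm :: real
  assumes "0 \<le> s"
    and opt: "\<And>z. 0 \<le> z \<Longrightarrow> share z 0 * vp + (1 - share z 0) * vm - z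
      \<le> share s 0 * vp + (1 - share s 0) * vm - s"
  shows "s = 0" "vp \<le> vm"
proof -
  show s: "s = 0"
    using opt[of "s / 2"] assms(1) by (auto simp: share_def split: if_splits)
  show "vp \<le> vm"
  proof (rule field_le_epsilon)
    fix e :: real assume "0 < e"
    then show "vp \<le> vm + e" using opt[of "e / 2"] s by (simp add: share_def split: if_splits)
  qed
qed

text \<open>First-order condition without derivatives: the gain from staking \<open>z\<close>
  instead of \<open>s\<close> is \<open>(z - s) * (K - z) / (c + z)\<close>, and it can be
  nonpositive for all \<open>z \<ge> 0\<close> only if \<open>K = s\<close>.\<close>

lemma optimal_stake_pos:
  fixes s c vp vm :: real
  assumes "0 < s" "0 < c"
    and opt: "\<And>z. 0 \<le> z \<Longrightarrow> share z c * vp + (1 - share z c) * vm - z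
      \<le> share s c * vp + (1 - share s c) * vm - s"
  shows "(s + c)\<^sup>2 = c * (vp - vm)"
proof -
  define K where "K = c * (vp - vm) / (s + c) - c"
  have key: "(z - s) * K \<le> (z - s) * z" if "0 \<le> z" for z
  proof -
    have "share z c * vp + (1 - share z c) * vm - z - (share s c * vp + (1 - share s c) * vm - s)
      = (z - s) * (K - z) / (c + z)"
      using assms(1,2) that unfolding share_def K_def by (simp add: divide_simps) (simp add: algebra_simps)
    then have "(z - s) * (K - z) / (c + z) \<le> 0"
      using opt[OF that] by linarith
    then have "(z - s) * (K - z) \<le> 0"
      using assms(2) that by (simp add: divide_le_0_iff)
    then show ?thesis by (simp add: algebra_simps)
  qed
  have "K \<le> s"
  proof (rule dense_ge)
    fix z assume "s < z"
    then show "K \<le> z" using key[of z] assms(1) by (simp add: mult_le_cancel_left)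
  qed
  moreover have "s \<le> K"
  proof (rule dense_le_bounded[of 0 s K])
    fix z assume "0 < z" "z < s"
    then show "z \<le> K" using key[of z] by (simp add: mult_le_cancel_left)
  qed (use assms in auto)
  ultimately have "K = s" by simp
  then show ?thesis
    using assms(1,2) by (simp add: K_def field_simps power2_eq_square)
qed

section \<open>Equilibria and ABMN solutions\<close>

lemma positive_ABMN_strict_mono:
  assumes "positive_ABMN a b m n"
  shows "m i < m (i + 1)" "n (i + 1) < n i"
  using assms[unfolded positive_ABMN_iff, rule_format, of i]
  by (smt (verit) divide_pos_pos zero_less_power)+

lemma int_mono_tendsto_bounds:
  fixes f :: "int \<Rightarrow> real"
  assumes mono: "\<And>i. f i \<le> f (i + 1)" and lim: "(f \<longlongrightarrow> L) at_bot" "(f \<longlongrightarrow> R) at_top"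
  shows "L \<le> f i" "f i \<le> R"
proof -
  have le: "f i \<le> f j" if "i \<le> j" for i j
    using that
  proof (induction j rule: int_ge_induct)
    case (step j)
    then show ?case using mono[of j] by linarith
  qed simp
  show "L \<le> f i"
    by (rule tendsto_upperbound[OF lim(1)])
      (auto intro!: eventually_mono[OF eventually_le_at_bot[of i]] le)
  show "f i \<le> R"
    by (rule tendsto_lowerbound[OF lim(2)])
      (auto intro!: eventually_mono[OF eventually_ge_at_top[of i]] le)
qed

lemma positive_ABMN_bounds:
  assumes s: "positive_ABMN a b m n"
    and lim: "(m \<longlongrightarrow> mL) at_bot" "(m \<longlongrightarrow> mR) at_top" "(n \<longlongrightarrow> nL) at_bot" "(n \<longlongrightarrow> nR) at_top"
  shows "mL \<le> m i" "m i \<le> mR" "nR \<le> n i" "n i \<le> nL"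
  using int_mono_tendsto_bounds[OF less_imp_le[OF positive_ABMN_strict_mono(1)[OF s]] lim(1,2), of i]
    int_mono_tendsto_bounds[of "\<lambda>i. - n i" "- nL" "- nR" i] positive_ABMN_strict_mono(2)[OF s]
    tendsto_minus[OF lim(3)] tendsto_minus[OF lim(4)]
  by (auto intro: less_imp_le)

text \<open>The expected gain of a stake \<open>s\<close> falls short by exactly
  \<open>(s - a)\<^sup>2 / (b + s)\<close>, so \<open>a\<close> is the best reply to
  \<open>b\<close> in one turn.\<close>

lemma stake_value_le:
  fixes a b s v :: real
  assumes "0 < a" "0 < b" "0 \<le> s" "v - vm = a\<^sup>2 / b" "vp - v = 2 * a + b"
  shows "share s b * vp + (1 - share s b) * vm \<le> v + s"
    and "share a b * vp + (1 - share a b) * vm = v + a"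
proof -
  have vm: "vm = v - a\<^sup>2 / b" and vp: "vp = v + 2 * a + b" using assms(4,5) by auto
  have *: "share z b * vp + (1 - share z b) * vm - (v + z) = - (z - a)\<^sup>2 / (b + z)" if "0 \<le> z" for z
    unfolding vm vp share_def using assms(1,2) that
    by (simp add: divide_simps) (simp add: algebra_simps power2_eq_square)
  have "- (s - a)\<^sup>2 / (b + s) \<le> 0"
    using assms by (simp add: divide_le_0_iff)
  with *[OF assms(3)] show "share s b * vp + (1 - share s b) * vm \<le> v + s" by linarith
  show "share a b * vp + (1 - share a b) * vm = v + a"
    using *[of a] assms(1) by simp
qed

text \<open>\<open>m\<close> and \<open>n\<close> are the payoffs of the candidate pair by the
  martingale case, and upper bounds for every unilateral deviation by the supermartingale
  case.\<close>

lemma ABMN_imp_nash: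
  assumes s: "positive_ABMN a b m n"
    and lim: "(m \<longlongrightarrow> mL) at_bot" "(m \<longlongrightarrow> mR) at_top" "(n \<longlongrightarrow> nL) at_bot" "(n \<longlongrightarrow> nR) at_top"
    and star: "mstar \<le> mL" "nstar \<le> nR"
  shows "nash_equilibrium mL mR nL nR mstar nstar (\<lambda>i _. b i) (\<lambda>i _. a i)"
proof -
  note h = s[unfolded positive_ABMN_iff, rule_format]
  note bd = positive_ABMN_bounds[OF s lim]
  let ?b = "\<lambda>i (_::nat). b i" and ?a = "\<lambda>i (_::nat). a i"
  have st: "strategy ?a" "strategy ?b" using h by (auto simp: strategy_def intro: less_imp_le)
  have max_eq: "maxine_payoff mL mR mstar ?b ?a k = ereal (m k)" for k
    unfolding maxine_payoff_def
  proof (rule expected_payoff_eq(1)[OF st(2,1,1), where s = a and v = m and lo = mL and hi = mR])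
    show "up_prob ?b ?a i (Suc t) * m (i + 1) + (1 - up_prob ?b ?a i (Suc t)) * m (i - 1) = m i + a i" for i t
      unfolding up_prob_share by (rule stake_value_le(2)[of _ _ 0]) (use h[of i] in auto)
  qed (use h bd lim in auto)
  have min_eq: "mina_payoff nL nR nstar ?b ?a k = ereal (n k)" for k
    unfolding mina_payoff_def
  proof (rule expected_payoff_eq(1)[OF st(2,1,2), where s = b and v = n and lo = nR and hi = nL])
    show "up_prob ?b ?a i (Suc t) * n (i + 1) + (1 - up_prob ?b ?a i (Suc t)) * n (i - 1) = n i + b i" for i t
      using stake_value_le(2)[of "b i" "a i" 0 "n i" "n (i + 1)" "n (i - 1)"] h[of i]
      by (simp add: up_prob_share share_swap[of "b i", symmetric])
  qed (use h bd lim in auto)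
  have "maxine_payoff mL mR mstar ?b S k \<le> ereal (m k)" if S: "strategy S" for S k
    unfolding maxine_payoff_def
  proof (rule expected_payoff_le[OF st(2) S S])
    show "up_prob ?b S i (Suc t) * m (i + 1) + (1 - up_prob ?b S i (Suc t)) * m (i - 1) \<le> m i + S i (Suc t)" for i t
      unfolding up_prob_share
      by (rule stake_value_le(1)[of "a i"]) (use h[of i] S in \<open>auto simp: strategy_def\<close>)
    \<comment> \<open>The supermartingale bound asks for a value function above the payoff without
      escape; \<open>mstar \<le> mL\<close> provides this.\<close>
    show "mstar \<le> m i" for i using bd(1)[of i] star by simp
  qed (use lim in auto)
  moreover have "mina_payoff nL nR nstar S ?a k \<le> ereal (n k)" if S: "strategy S" for S k
    unfolding mina_payoff_def
  proof (rule expected_payoff_le[OF S st(1) S])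
    show "up_prob S ?a i (Suc t) * n (i + 1) + (1 - up_prob S ?a i (Suc t)) * n (i - 1) \<le> n i + S i (Suc t)" for i t
      using stake_value_le(1)[of "b i" "a i" "S i (Suc t)" "n i" "n (i + 1)" "n (i - 1)"] h[of i] S
      by (simp add: up_prob_share share_swap[of "S i (Suc t)", symmetric] strategy_def)
    show "nstar \<le> n i" for i using bd(3)[of i] star by simp
  qed (use lim in auto)
  ultimately show ?thesis
    unfolding nash_equilibrium_def max_eq min_eq using st by blast
qed

section \<open>From a time-invariant equilibrium to a solution\<close>

lemma time_invariant_nash:
  assumes "time_invariant Sm" "time_invariant Sp" "nash_equilibrium mL mR nL nR mstar nstar Sm Sp"
  shows "nash_equilibrium mL mR nL nR mstar nstar (\<lambda>i _. Sm i 1) (\<lambda>i _. Sp i 1)"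
proof -
  have eq: "Sm i (Suc t) = Sm i 1" "Sp i (Suc t) = Sp i 1" for i t
    using assms(1,2)[unfolded time_invariant_def, rule_format, of "Suc t" 1 i] by auto
  have "maxine_payoff mL mR mstar (\<lambda>i _. Sm i 1) (\<lambda>i _. Sp i 1) k = maxine_payoff mL mR mstar Sm Sp k"
    "mina_payoff nL nR nstar (\<lambda>i _. Sm i 1) (\<lambda>i _. Sp i 1) k = mina_payoff nL nR nstar Sm Sp k"
    "maxine_payoff mL mR mstar (\<lambda>i _. Sm i 1) S k = maxine_payoff mL mR mstar Sm S k"
    "mina_payoff nL nR nstar S (\<lambda>i _. Sp i 1) k = mina_payoff nL nR nstar S Sp k" for S k
    unfolding maxine_payoff_def mina_payoff_def
    by (rule expected_payoff_cong; simp only: eq)+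
  then show ?thesis
    using assms(3) by (simp add: nash_equilibrium_def strategy_def)
qed

lemma share_mix:
  assumes "0 < s" "0 < c"
  shows "(s + c) * (share s c * u + (1 - share s c) * w) = s * u + c * w"
proof -
  have e: "share s c = s / (s + c)" "share c s = c / (s + c)" and nz: "s + c \<noteq> 0"
    using assms by (simp_all add: share_def add.commute)
  show ?thesis unfolding share_swap unfolding e using nz by (simp add: distrib_left)
qed

lemma later_const: "later (\<lambda>i _. f i) = (\<lambda>i _. f i)"
  by (simp add: later_def fun_eq_iff)

text \<open>As in the ABMN system, \<open>a\<close> holds Maxine's stakes and \<open>b\<close>
  Mina's.\<close>

locale stationary_nash =
  fixes a b :: "int \<Rightarrow> real" and x mstar nstar :: real
  assumes x: "0 < x" and star: "mstar \<le> 0" "nstar \<le> 0"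
    and nash: "nash_equilibrium 0 1 x 0 mstar nstar (\<lambda>i _. b i) (\<lambda>i _. a i)"
begin

abbreviation "Sm \<equiv> \<lambda>i (_::nat). b i"
abbreviation "Sp \<equiv> \<lambda>i (_::nat). a i"

lemma strategies: "strategy Sm" "strategy Sp"
  using nash by (auto simp: nash_equilibrium_def)

lemma stakes_nonneg: "0 \<le> a i" "0 \<le> b i"
  using strategies by (auto simp: strategy_def)

lemma maxine_deviation: "strategy S \<Longrightarrow> maxine_payoff 0 1 mstar Sm S k \<le> maxine_payoff 0 1 mstar Sm Sp k"
  and mina_deviation: "strategy S \<Longrightarrow> mina_payoff x 0 nstar S Sp k \<le> mina_payoff x 0 nstar Sm Sp k"
  using nash by (auto simp: nash_equilibrium_def)

definition m :: "int \<Rightarrow> real" where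
  "m k = real_of_ereal (maxine_payoff 0 1 mstar Sm Sp k)"

definition n :: "int \<Rightarrow> real" where
  "n k = real_of_ereal (mina_payoff x 0 nstar Sm Sp k)"

text \<open>The lower bounds come from deviating to zero stakes, which costs nothing. Hence the
  equilibrium payoffs are finite and \<open>m\<close> and \<open>n\<close> lose no
  information.\<close>

lemma payoff_bounds:
  "ereal mstar \<le> maxine_payoff 0 1 mstar Sm Sp k" "maxine_payoff 0 1 mstar Sm Sp k \<le> ereal 1"
  "ereal nstar \<le> mina_payoff x 0 nstar Sm Sp k" "mina_payoff x 0 nstar Sm Sp k \<le> ereal x"
proof -
  have zero: "strategy (\<lambda>_ _. 0)" by (simp add: strategy_def)
  show "maxine_payoff 0 1 mstar Sm Sp k \<le> ereal 1" "mina_payoff x 0 nstar Sm Sp k \<le> ereal x"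
    unfolding maxine_payoff_def mina_payoff_def
    by (rule expected_payoff_le_max; use x star in simp)+
  show "ereal mstar \<le> maxine_payoff 0 1 mstar Sm Sp k"
    by (rule order_trans[OF _ maxine_deviation[OF zero]])
      (use star in \<open>simp add: maxine_payoff_def expected_payoff_zero_stakes integral_terminal_ge\<close>)
  show "ereal nstar \<le> mina_payoff x 0 nstar Sm Sp k"
    by (rule order_trans[OF _ mina_deviation[OF zero]])
      (use x star in \<open>simp add: mina_payoff_def expected_payoff_zero_stakes integral_terminal_ge\<close>)
qed

lemma payoff_eq: "maxine_payoff 0 1 mstar Sm Sp k = ereal (m k)" "mina_payoff x 0 nstar Sm Sp k = ereal (n k)"
  unfolding m_def n_def using payoff_bounds[of k]
  by (cases "maxine_payoff 0 1 mstar Sm Sp k"; cases "mina_payoff x 0 nstar Sm Sp k"; simp)+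

lemma value_bounds: "mstar \<le> m k" "m k \<le> 1" "nstar \<le> n k" "n k \<le> x"
  using payoff_bounds[of k] by (simp_all add: payoff_eq)

text \<open>A deviation confined to the first turn is followed by equilibrium play, whose payoff is
  again \<open>m\<close>.\<close>

lemma maxine_first_stake:
  assumes "0 \<le> z"
  shows "maxine_payoff 0 1 mstar Sm (\<lambda>i t. if t = 1 then z else a i) k
    = ereal (share z (b k) * m (k + 1) + (1 - share z (b k)) * m (k - 1) - z)"
proof -
  let ?S = "\<lambda>i t. if t = 1 then z else a i"
  have "strategy ?S" using assms stakes_nonneg by (simp add: strategy_def)
  moreover have "expected_payoff 0 1 mstar (later ?S) (later Sm) (later ?S) j = ereal (m j)" for j
    unfolding payoff_eq(1)[symmetric] maxine_payoff_def
    by (rule expected_payoff_cong) (simp_all add: later_def)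
  ultimately show ?thesis
    unfolding maxine_payoff_def
    by (subst expected_payoff_first_step[OF strategies(1)]) (simp_all add: up_prob_share)
qed

lemma mina_first_stake:
  assumes "0 \<le> z"
  shows "mina_payoff x 0 nstar (\<lambda>i t. if t = 1 then z else b i) Sp k
    = ereal (share z (a k) * n (k - 1) + (1 - share z (a k)) * n (k + 1) - z)"
proof -
  let ?S = "\<lambda>i t. if t = 1 then z else b i"
  have "strategy ?S" using assms stakes_nonneg by (simp add: strategy_def)
  moreover have "expected_payoff x 0 nstar (later ?S) (later ?S) (later Sp) j = ereal (n j)" for j
    unfolding payoff_eq(2)[symmetric] mina_payoff_def
    by (rule expected_payoff_cong) (simp_all add: later_def)
  ultimately show ?thesis
    unfolding mina_payoff_def
    by (subst expected_payoff_first_step[OF _ strategies(2)])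
      (simp_all add: up_prob_share share_swap add.commute)
qed

lemma first_step:
  "m k = share (a k) (b k) * m (k + 1) + (1 - share (a k) (b k)) * m (k - 1) - a k"
  "n k = share (b k) (a k) * n (k - 1) + (1 - share (b k) (a k)) * n (k + 1) - b k"
proof -
  note eq = payoff_eq[unfolded maxine_payoff_def mina_payoff_def]
  have "ereal (m k) = ereal (up_prob Sm Sp k 1 * m (k + 1) + (1 - up_prob Sm Sp k 1) * m (k - 1) - a k)"
    unfolding eq(1)[symmetric]
    by (rule expected_payoff_first_step[OF strategies strategies(2)]) (simp_all only: later_const eq)
  then show "m k = share (a k) (b k) * m (k + 1) + (1 - share (a k) (b k)) * m (k - 1) - a k"
    by (simp add: up_prob_share)
  have "ereal (n k) = ereal (up_prob Sm Sp k 1 * n (k + 1) + (1 - up_prob Sm Sp k 1) * n (k - 1) - b k)"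
    unfolding eq(2)[symmetric]
    by (rule expected_payoff_first_step[OF strategies strategies(1)]) (simp_all only: later_const eq)
  then show "n k = share (b k) (a k) * n (k - 1) + (1 - share (b k) (a k)) * n (k + 1) - b k"
    by (simp add: up_prob_share share_swap)
qed

lemma optimality:
  assumes "0 \<le> z"
  shows "share z (b k) * m (k + 1) + (1 - share z (b k)) * m (k - 1) - z
      \<le> share (a k) (b k) * m (k + 1) + (1 - share (a k) (b k)) * m (k - 1) - a k"
    and "share z (a k) * n (k - 1) + (1 - share z (a k)) * n (k + 1) - z
      \<le> share (b k) (a k) * n (k - 1) + (1 - share (b k) (a k)) * n (k + 1) - b k"
proof -
  have "strategy (\<lambda>i t. if t = 1 then z else a i)" "strategy (\<lambda>i t. if t = 1 then z else b i)"
    using assms stakes_nonneg by (simp_all add: strategy_def)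
  from maxine_deviation[OF this(1), of k] mina_deviation[OF this(2), of k]
  show "share z (b k) * m (k + 1) + (1 - share z (b k)) * m (k - 1) - z
      \<le> share (a k) (b k) * m (k + 1) + (1 - share (a k) (b k)) * m (k - 1) - a k"
    "share z (a k) * n (k - 1) + (1 - share z (a k)) * n (k + 1) - z
      \<le> share (b k) (a k) * n (k - 1) + (1 - share (b k) (a k)) * n (k + 1) - b k"
    unfolding maxine_first_stake[OF assms] mina_first_stake[OF assms] payoff_eq first_step[symmetric]
    by simp_all
qed

text \<open>If one stake vanishes, the best reply to it is zero, so both vanish; then
  \<open>m (k + 1) \<le> m (k - 1)\<close> with \<open>m k\<close> their average. If both are
  positive, the first-order conditions and the first-step identities are the ABMN equations at
  \<open>k\<close>.\<close>

lemma site_dichotomy: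
  obtains (zero) "a k = 0" "b k = 0" "m (k + 1) \<le> m k" "m k \<le> m (k - 1)"
  | (pos) "0 < a k" "0 < b k" "m k - m (k - 1) = (a k)\<^sup>2 / b k" "m (k + 1) - m k = 2 * a k + b k"
      "n k - n (k + 1) = (b k)\<^sup>2 / a k" "n (k - 1) - n k = 2 * b k + a k"
proof (cases "a k = 0 \<or> b k = 0")
  case True
  have 0: "a k = 0" "b k = 0"
    using True optimal_stake_zero(1)[OF stakes_nonneg(1)[of k], of "m (k + 1)" "m (k - 1)"]
      optimal_stake_zero(1)[OF stakes_nonneg(2)[of k], of "n (k - 1)" "n (k + 1)"]
      optimality[of _ k] by auto
  then have "m (k + 1) \<le> m (k - 1)"
    using optimal_stake_zero(2)[OF stakes_nonneg(1)[of k], of "m (k + 1)" "m (k - 1)"]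
      optimality(1)[of _ k] by simp
  then show ?thesis
    using first_step(1)[of k] 0 by (intro zero) (simp_all add: share_def)
next
  case False
  then have p: "0 < a k" "0 < b k" using stakes_nonneg[of k] by auto
  have eq: "(a k + b k)\<^sup>2 = b k * (m (k + 1) - m (k - 1))"
    "(b k + a k)\<^sup>2 = a k * (n (k - 1) - n (k + 1))"
    using optimal_stake_pos[OF p optimality(1)] optimal_stake_pos[OF p(2,1) optimality(2)] by blast+
  have "(a k + b k) * (m k + a k) = a k * m (k + 1) + b k * m (k - 1)"
    "(b k + a k) * (n k + b k) = b k * n (k - 1) + a k * n (k + 1)"
  proof -
    have "m k + a k = share (a k) (b k) * m (k + 1) + (1 - share (a k) (b k)) * m (k - 1)"
      "n k + b k = share (b k) (a k) * n (k - 1) + (1 - share (b k) (a k)) * n (k + 1)"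
      using first_step[of k] by linarith+
    then show "(a k + b k) * (m k + a k) = a k * m (k + 1) + b k * m (k - 1)"
      "(b k + a k) * (n k + b k) = b k * n (k - 1) + a k * n (k + 1)"
      using share_mix[OF p] share_mix[OF p(2,1)] by (simp_all only:)
  qed
  then show ?thesis
    using abmn_site_iff[OF p, of "m k" "m (k + 1)" "m (k - 1)"]
      abmn_site_iff[OF p(2,1), of "n k" "n (k - 1)" "n (k + 1)"] p eq
    by (intro pos) auto
qed

text \<open>If nobody ever staked, either player could buy every turn at arbitrarily small cost, so
  the free game would have to pay Maxine 1 and Mina \<open>x\<close> at once.\<close>

lemma not_all_zero: "\<exists>k. a k \<noteq> 0 \<or> b k \<noteq> 0"
proof (rule ccontr)
  assume "\<not> ?thesis"
  then have zero: "a = (\<lambda>_. 0)" "b = (\<lambda>_. 0)" by auto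
  let ?X = "gameplay (\<lambda>_ _. 0) (\<lambda>_ _. 0) 0"
  have S: "strategy (\<lambda>_ t. e * (1 / 2) ^ t)" if "0 < e" for e :: real
    using that by (simp add: strategy_def)
  have "1 \<le> m 0"
  proof (rule field_le_epsilon)
    fix e :: real assume "0 < e"
    then show "1 \<le> m 0 + e"
      using maxine_deviation[OF S, of e 0] expected_payoff_buy_right[of e 0 1 mstar 0]
      unfolding payoff_eq by (simp add: maxine_payoff_def zero)
  qed
  then have 1: "1 \<le> (\<integral>\<omega>. terminal 0 1 mstar (?X \<omega>) \<partial>noise)"
    using payoff_eq(1)[of 0] by (simp add: maxine_payoff_def zero expected_payoff_zero_stakes)
  have "x \<le> n 0"
  proof (rule field_le_epsilon)
    fix e :: real assume "0 < e"
    then show "x \<le> n 0 + e"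
      using mina_deviation[OF S, of e 0] expected_payoff_buy_left[of e x 0 nstar 0]
      unfolding payoff_eq by (simp add: mina_payoff_def zero)
  qed
  then have 2: "x \<le> (\<integral>\<omega>. terminal x 0 nstar (?X \<omega>) \<partial>noise)"
    using payoff_eq(2)[of 0] by (simp add: mina_payoff_def zero expected_payoff_zero_stakes)
  \<comment> \<open>Weighting Maxine by \<open>x\<close> gives total \<open>x\<close> on either
    escape and at most 0 otherwise, so the two demands, which total \<open>2 * x\<close>, are
    incompatible.\<close>
  have "x * terminal 0 1 mstar X + terminal x 0 nstar X \<le> x" for X
    using x star mult_nonneg_nonpos[of x mstar] not_escape_both[of X] by (auto simp: terminal_def)
  then have "(\<integral>\<omega>. x * terminal 0 1 mstar (?X \<omega>) + terminal x 0 nstar (?X \<omega>) \<partial>noise) \<le> x"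
    by (intro noise.integral_le_const) auto
  then have "x * (\<integral>\<omega>. terminal 0 1 mstar (?X \<omega>) \<partial>noise) + (\<integral>\<omega>. terminal x 0 nstar (?X \<omega>) \<partial>noise) \<le> x"
    by simp
  then show False
    using 2 x mult_left_mono[OF 1, of x] by linarith
qed

text \<open>At a site with positive stakes \<open>m\<close> increases strictly to both neighbours'
  edges, while a neighbour with zero stakes would make \<open>m\<close> nonincreasing across the
  shared edge. Positivity therefore spreads from one site to all.\<close>

lemma positive_ABMN: "positive_ABMN a b m n"
proof -
  have up: "0 < a (k + 1)" if "0 < a k" for k
  proof -
    have "0 < a k \<longrightarrow> m k < m (k + 1)"
      using stakes_nonneg(2)[of k] by (cases rule: site_dichotomy[of k]) auto
    with that show ?thesis by (cases rule: site_dichotomy[of "k + 1"]) auto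
  qed
  have down: "0 < a (k - 1)" if "0 < a k" for k
  proof -
    have "0 < a k \<longrightarrow> m (k - 1) < m k"
      by (cases rule: site_dichotomy[of k]) (auto intro: diff_gt_0_iff_gt[THEN iffD1])
    with that show ?thesis by (cases rule: site_dichotomy[of "k - 1"]) auto
  qed
  obtain k0 where k0: "a k0 \<noteq> 0 \<or> b k0 \<noteq> 0" using not_all_zero by blast
  have "0 < a k0" by (cases rule: site_dichotomy[of k0]) (use k0 in auto)
  then have pos: "0 < a k" for k
    by (induction k rule: int_induct[of _ k0]) (auto intro: up down)
  show ?thesis
    unfolding positive_ABMN_iff
  proof
    fix k
    show "0 < a k \<and> 0 < b k \<and>
     m k - m (k - 1) = (a k)\<^sup>2 / b k \<and> m (k + 1) - m k = 2 * a k + b k \<and>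
     n k - n (k + 1) = (b k)\<^sup>2 / a k \<and> n (k - 1) - n k = 2 * b k + a k"
      by (cases rule: site_dichotomy[of k]) (use pos[of k] in auto)
  qed
qed

text \<open>The equilibrium value is the expected payoff both for the boundary data of the game and
  for the limits of \<open>m\<close> and \<open>n\<close>. The running costs are the same, so the
  expected terminal values agree from every starting point; this forces the limits to be the data of
  the game.\<close>

lemma margin: "x \<in> mina_margins"
proof -
  note s = positive_ABMN
  obtain mL mR nL nR where lim: "(m \<longlongrightarrow> mL) at_bot" "(m \<longlongrightarrow> mR) at_top"
    "(n \<longlongrightarrow> nL) at_bot" "(n \<longlongrightarrow> nR) at_top"
    using positive_ABMN_tendsto_at_top[OF s] positive_ABMN_tendsto_at_bot[OF s] by blast
  have lt: "mL < mR" "nR < nL" using positive_ABMN_margin[OF s lim] by auto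
  have pos: "0 < a i" "0 < b i" for i using s by (auto simp: positive_ABMN_iff)
  have stepm: "up_prob Sm Sp i (Suc t) * m (i + 1) + (1 - up_prob Sm Sp i (Suc t)) * m (i - 1) = m i + a i" for i t
    using first_step(1)[of i] unfolding up_prob_share by linarith
  have stepn: "up_prob Sm Sp i (Suc t) * n (i + 1) + (1 - up_prob Sm Sp i (Suc t)) * n (i - 1) = n i + b i" for i t
    using first_step(2)[of i] unfolding up_prob_share share_swap by linarith
  note maxine = expected_payoff_eq[OF strategies strategies(2) refl pos(1) value_bounds(1,2) lim(1,2) stepm]
  note mina = expected_payoff_eq[OF strategies strategies(1) refl pos(2) value_bounds(3,4) lim(3,4) stepn]
  \<comment> \<open>Probability of escaping left. As escape is almost sure, every expected terminal
    value is affine in it.\<close>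
  define P where "P k = (\<integral>\<omega>. terminal 1 0 0 (gameplay Sm Sp k \<omega>) \<partial>noise)" for k
  have T: "(\<integral>\<omega>. terminal vL vR vs (gameplay Sm Sp k \<omega>) \<partial>noise) = vR + (vL - vR) * P k" for vL vR vs k
  proof -
    have "(\<integral>\<omega>. terminal vL vR vs (gameplay Sm Sp k \<omega>) \<partial>noise)
      = (\<integral>\<omega>. vR + (vL - vR) * terminal 1 0 0 (gameplay Sm Sp k \<omega>) \<partial>noise)"
      by (rule integral_cong_AE) (use maxine(2)[of k] in \<open>auto simp: terminal_def\<close>)
    then show ?thesis by (simp add: P_def noise.prob_space)
  qed
  have m_eq: "mR + (mL - mR) * P k = 1 - P k" and m_le: "m k \<le> mR - (mR - mL) * P k" for k
  proof -
    obtain c where c: "0 \<le> c" "(\<integral>\<^sup>+\<omega>. running_cost Sp (gameplay Sm Sp k \<omega>) \<partial>noise) = ennreal c"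
      "m k = (\<integral>\<omega>. terminal mL mR mstar (gameplay Sm Sp k \<omega>) \<partial>noise) - c"
      using expected_payoff_realE[OF maxine(1)] .
    obtain c' where c': "0 \<le> c'" "(\<integral>\<^sup>+\<omega>. running_cost Sp (gameplay Sm Sp k \<omega>) \<partial>noise) = ennreal c'"
      "m k = (\<integral>\<omega>. terminal 0 1 mstar (gameplay Sm Sp k \<omega>) \<partial>noise) - c'"
      using expected_payoff_realE[OF payoff_eq(1)[unfolded maxine_payoff_def]] .
    have "c = c'" using c(1,2) c'(1,2) by simp
    then show "mR + (mL - mR) * P k = 1 - P k" using c(3) c'(3) unfolding T by simp
    show "m k \<le> mR - (mR - mL) * P k" using c(1,3) unfolding T by (simp add: algebra_simps)
  qed
  have n_eq: "nR + (nL - nR) * P k = x * P k" and n_le: "n k \<le> nR + (nL - nR) * P k" for k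
  proof -
    obtain c where c: "0 \<le> c" "(\<integral>\<^sup>+\<omega>. running_cost Sm (gameplay Sm Sp k \<omega>) \<partial>noise) = ennreal c"
      "n k = (\<integral>\<omega>. terminal nL nR nstar (gameplay Sm Sp k \<omega>) \<partial>noise) - c"
      using expected_payoff_realE[OF mina(1)] .
    obtain c' where c': "0 \<le> c'" "(\<integral>\<^sup>+\<omega>. running_cost Sm (gameplay Sm Sp k \<omega>) \<partial>noise) = ennreal c'"
      "n k = (\<integral>\<omega>. terminal x 0 nstar (gameplay Sm Sp k \<omega>) \<partial>noise) - c'"
      using expected_payoff_realE[OF payoff_eq(2)[unfolded mina_payoff_def]] .
    have "c = c'" using c(1,2) c'(1,2) by simp
    then show "nR + (nL - nR) * P k = x * P k" using c(3) c'(3) unfolding T by simp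
    show "n k \<le> nR + (nL - nR) * P k" using c(1,3) unfolding T by simp
  qed
  have P: "0 \<le> P k" "P k \<le> 1" for k
    unfolding P_def by (rule integral_terminal_ge integral_terminal_le; simp)+
  \<comment> \<open>Costs are nonnegative, so \<open>m k\<close> near its supremum \<open>mR\<close>
    leaves little room for escape to the left; \<open>n\<close> gives the other end.\<close>
  have P_top: "(P \<longlongrightarrow> 0) at_top"
  proof (rule tendsto_sandwich[where f = "\<lambda>_. 0" and h = "\<lambda>k. (mR - m k) / (mR - mL)"])
    show "((\<lambda>k. (mR - m k) / (mR - mL)) \<longlongrightarrow> 0) at_top"
      using tendsto_divide[OF tendsto_diff[OF tendsto_const lim(2), of mR] tendsto_const, of "mR - mL"] lt by simp
    show "\<forall>\<^sub>F k in at_top. P k \<le> (mR - m k) / (mR - mL)"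
      using m_le lt by (intro always_eventually) (simp add: field_simps)
  qed (use P in \<open>simp_all add: always_eventually\<close>)
  have P_bot: "(P \<longlongrightarrow> 1) at_bot"
  proof (rule tendsto_sandwich[where f = "\<lambda>k. (n k - nR) / (nL - nR)" and h = "\<lambda>_. 1"])
    show "((\<lambda>k. (n k - nR) / (nL - nR)) \<longlongrightarrow> 1) at_bot"
      using tendsto_divide[OF tendsto_diff[OF lim(3) tendsto_const, of nR] tendsto_const, of "nL - nR"] lt by simp
    show "\<forall>\<^sub>F k in at_bot. (n k - nR) / (nL - nR) \<le> P k"
      using n_le lt by (intro always_eventually) (simp add: field_simps)
  qed (use P in \<open>simp_all add: always_eventually\<close>)
  \<comment> \<open>\<open>P\<close> has the two distinct limits 0 and 1, so a vanishing affine
    function of it has zero coefficients.\<close>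
  have affine: "c = 0 \<and> d = 0" if "\<And>k. c + d * P k = 0" for c d
  proof -
    have "((\<lambda>k. c + d * P k) \<longlongrightarrow> c + d * 0) at_top" "((\<lambda>k. c + d * P k) \<longlongrightarrow> c + d * 1) at_bot"
      by (intro tendsto_intros P_top P_bot)+
    then show ?thesis
      unfolding that by (auto simp: tendsto_const_iff)
  qed
  have "mR - 1 + (mL - mR + 1) * P k = 0" "nR + (nL - nR - x) * P k = 0" for k
    using m_eq[of k] n_eq[of k] by (simp_all add: algebra_simps)
  then have "mR - 1 = 0 \<and> mL - mR + 1 = 0" "nR = 0 \<and> nL - nR - x = 0"
    by (intro affine; simp only:)+
  then have "mR = 1" "mL = 0" "nR = 0" "nL = x" by linarith+
  then have "x = (nL - nR) / (mR - mL)" by simp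
  with s lim show ?thesis
    unfolding mina_margins_def by blast
qed

end

theorem mainTheorem4:
  fixes x mstar nstar :: real
  assumes "0 < x" and "mstar \<le> 0" and "nstar \<le> 0"
  shows "(\<exists>Sm Sp. time_invariant Sm \<and> time_invariant Sp \<and>
            nash_equilibrium 0 1 x 0 mstar nstar Sm Sp)
         \<longleftrightarrow> x \<in> {lambda_ABMN .. 1 / lambda_ABMN}"
  unfolding mina_margins_eq[symmetric]
proof
  assume "\<exists>Sm Sp. time_invariant Sm \<and> time_invariant Sp \<and> nash_equilibrium 0 1 x 0 mstar nstar Sm Sp"
  then obtain Sm Sp where "time_invariant Sm" "time_invariant Sp" "nash_equilibrium 0 1 x 0 mstar nstar Sm Sp"
    by blast
  then interpret stationary_nash "\<lambda>i. Sp i 1" "\<lambda>i. Sm i 1" x mstar nstar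
    by unfold_locales (use assms time_invariant_nash in auto)
  show "x \<in> mina_margins" by (rule margin)
next
  assume "x \<in> mina_margins"
  then obtain a b m n where s: "positive_ABMN a b m n" and
    lim: "(m \<longlongrightarrow> 0) at_bot" "(m \<longlongrightarrow> 1) at_top" "(n \<longlongrightarrow> x) at_bot" "(n \<longlongrightarrow> 0) at_top"
    by (rule standard_ABMN_exists)
  have "nash_equilibrium 0 1 x 0 mstar nstar (\<lambda>i _. b i) (\<lambda>i _. a i)"
    by (rule ABMN_imp_nash[OF s lim assms(2,3)])
  then show "\<exists>Sm Sp. time_invariant Sm \<and> time_invariant Sp \<and> nash_equilibrium 0 1 x 0 mstar nstar Sm Sp"
    by (intro exI[of _ "\<lambda>i _. b i"] exI[of _ "\<lambda>i _. a i"]) (simp add: time_invariant_def)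
qed

end
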